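(* Let $n\ge2$ and $k\ge1$. Suppose that $p$ is a point of the Monster tower lying in the R-stabilization of the class $R^kV$ (i.e. $p$ has RVT code $R^kVR^q$ for some $q\ge1$) and that $\gamma\in Germ(p)$. Then $\gamma$ is an $A_{2k}$ singularity.
   Context: All manifolds, curves and maps are complex analytic. A distribution on $Z$ is a subbundle $D\subset TZ$. If $D$ has rank $m$, put $\mathbb P D=\{(z,\ell): z\in Z,\ \ell\subset D(z)\text{ a line}\}$ with projection $\pi:\mathbb P D\to Z$, and define the rank $m$ distribution $D^1$ on $\mathbb PD$ by $D^1(z,\ell)=d\pi_{(z,\ell)}^{-1}(\ell)$. The prolongation of a nonconstant integral curve $\gamma$ of $D$ is the integral curve $\gamma^1$ of $D^1$ given by $\gamma^1(t)=(\gamma(t),\mathrm{span}\,\gamma'(t))$ where $\gamma'(t)\neq0$, extended by limits to the other $t$; $\gamma^{j+1}=(\gamma^j)^1$, $\gamma^0=\gamma$. Monster tower: $\mathcal P^0(n)=\mathbb C^n$, $\Delta_0=T\mathbb C^n$, $\mathcal P^{k}(n)=\mathbb P\Delta_{k-1}$, $\Delta_k=(\Delta_{k-1})^1$ (rank $n$), with projections $\pi_{k,i}:\mathcal P^k(n)\to\mathcal P^i(n)$; for $p\in\mathcal P^k(n)$ put $p_i=\pi_{k,i}(p)$. For $k\ge1$ the vertical space at $p\in\mathcal P^k(n)$ is $V_k(p)=\ker d\pi_{k,k-1}(p)\subset\Delta_k(p)$. For $i\ge1$ let $F_i(p_i)=\pi_{i,i-1}^{-1}(p_{i-1})$, an integral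 submanifold of $\Delta_i$. Any manifold $F$ has its own tower $\mathcal P^0(F)=F$, $\Delta_0^F=TF$, $\mathcal P^{j+1}(F)=\mathbb P\Delta_j^F$, $\Delta_{j+1}^F=(\Delta_j^F)^1$, and $\mathcal P^j(F_i(p_i))\subset\mathcal P^{i+j}(n)$. The critical hyperplanes through $p\in\mathcal P^k(n)$ are the hyperplanes $\delta_i^j(p)=\Delta_j^{F_i(p_i)}(p)\subset\Delta_k(p)$ for those $i\ge1,j\ge0$, $i+j=k$, with $p\in\mathcal P^j(F_i(p_i))$ (so $\delta_k^0=V_k$). A line in $\Delta_k(p)$ is regular if it lies in no critical hyperplane, critical otherwise, and vertical if it lies in $V_k(p)$ (at level $0$ every line is regular). A point $p=(p_{k-1},\ell)\in\mathcal P^k(n)$, $k\ge1$, is called regular, critical or vertical according to the line $\ell\subset\Delta_{k-1}(p_{k-1})$. An integral curve germ $\sigma$ of $\Delta_k$ is regular if $\sigma'(0)\ne0$ spans a regular line. The RVT code of $p\in\mathcal P^k(n)$ is the word $\omega_1\dots\omega_k$ with $\omega_i=R$ if $p_i$ is regular, $V$ if $p_i$ is vertical, and $T$ if $p_i$ is critical but not vertical. An RVT class is the set of points with a given code; $R^k$ means $R$ repeated $k$ times. $Germ(p)$, $p\in\mathcal P^k(n)$, is the set of curve germs $\gamma:(\mathbb C,0)\to\mathbb C^n$ with $\gamma^k(0)=p$ and $\gamma^k$ regular. An $A_{2k}$ singularity is a curve germ in $\mathbb C^n$ that becomes, after a local analytic diffeomorphism of $\mathbb C^n$ and a reparameterization,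 the curve $x_1=t^2,\ x_2=t^{2k+1},\ x_3=\dots=x_n=0$. *)

theory Defs
  imports "HOL-Analysis.Analysis"
begin

text \<open>
  The space \<open>\<complex>\<^sup>n\<close> is \<open>complex ^ 'n\<close>, with \<open>n = CARD('n)\<close>.

  A tangent vector is given by its coordinates in every chart of the manifold at hand (and by 0
  in the charts not containing the base point). The charts of the \<open>k\<close>-th level are indexed by
  words of length \<open>k\<close>, so this type serves all levels at once.
\<close>

type_synonym 'n tvec = "'n list \<Rightarrow> nat \<Rightarrow> complex ^ 'n"

definition tzero :: "'n::finite tvec" where
  "tzero = (\<lambda>w i. 0)"

definition tspan :: "'n::finite tvec \<Rightarrow> 'n tvec set" where
  "tspan v = {(\<lambda>w i. c *s v w i) | c. True}"

text \<open>\<open>Prol z l\<close> is the pair \<open>(z, l)\<close> of a point and a line of tangent vectors at that point.\<close>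

datatype 'n mpoint = Base "complex ^ 'n::finite" | Prol "'n mpoint" "'n tvec set"

primrec level :: "'n::finite mpoint \<Rightarrow> nat" where
  "level (Base x) = 0"
| "level (Prol z l) = Suc (level z)"

fun proj :: "'n::finite mpoint \<Rightarrow> 'n mpoint" where
  "proj (Base x) = Base x"
| "proj (Prol z l) = z"

fun line_of :: "'n::finite mpoint \<Rightarrow> 'n tvec set" where
  "line_of (Base x) = {}"
| "line_of (Prol z l) = l"

text \<open>
  The complex manifold structure of the tower. In the chart with word \<open>w\<close> of length \<open>k\<close> (last
  letter first) the coordinates \<open>y i b\<close>, \<open>i \<le> k\<close>, are obtained as follows: \<open>y 0\<close> are the
  coordinates of \<open>\<complex>\<^sup>n\<close>, and the differentials of \<open>y k b\<close>, \<open>b\<close> in \<open>'n\<close>, restrict to a coframe of the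
  rank \<open>n\<close> distribution on the \<open>k\<close>-th level, so they are homogeneous coordinates on the lines in
  that distribution. The chart \<open>a # w\<close> is the affine chart \<open>dy k a \<noteq> 0\<close>, with the new affine
  coordinates \<open>y (k+1) b = dy k b / dy k a\<close> for \<open>b \<noteq> a\<close>. The entry \<open>y (k+1) a\<close> is a copy of
  \<open>y k a\<close>; thus a chart takes its values in a linear subspace of dimension \<open>n + k * (n - 1)\<close>, namely
  the one on which the copies agree (the entries \<open>y i\<close> with \<open>i > k\<close> are 0).
\<close>

fun in_chart :: "'n::finite list \<Rightarrow> 'n mpoint \<Rightarrow> bool" where
  "in_chart [] (Base x) \<longleftrightarrow> True"
| "in_chart (a # w) (Prol z l) \<longleftrightarrow> in_chart w z \<and> (\<exists>v\<in>l. v w (length w) $ a \<noteq> 0)"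
| "in_chart _ _ \<longleftrightarrow> False"

fun chart :: "'n::finite list \<Rightarrow> 'n mpoint \<Rightarrow> nat \<Rightarrow> complex ^ 'n" where
  "chart [] (Base x) = (\<lambda>i. if i = 0 then x else 0)"
| "chart (a # w) (Prol z l) = (chart w z)(Suc (length w) :=
     (\<chi> b. if b = a then chart w z (length w) $ a
           else (THE u. \<forall>v\<in>l. v w (length w) $ b = u * v w (length w) $ a)))"
| "chart _ _ = (\<lambda>i. 0)"

definition holo_germ :: "'n::finite mpoint set \<Rightarrow> (complex \<Rightarrow> 'n mpoint) \<Rightarrow> bool" where
  "holo_germ S c \<longleftrightarrow> (\<forall>\<^sub>F t in nhds 0. c t \<in> S) \<and>
     (\<exists>w. (\<forall>\<^sub>F t in nhds 0. in_chart w (c t)) \<and>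
          (\<forall>i b. (\<lambda>t. chart w (c t) i $ b) analytic_on {0}))"

definition velocity :: "(complex \<Rightarrow> 'n::finite mpoint) \<Rightarrow> complex \<Rightarrow> 'n tvec" where
  "velocity c t = (\<lambda>w i. if in_chart w (c t)
     then (\<chi> b. deriv (\<lambda>s. chart w (c s) i $ b) t) else 0)"

text \<open>Tangent space at \<open>p\<close> of an embedded submanifold \<open>S\<close> of some level of the tower.\<close>

definition tangent :: "'n::finite mpoint set \<Rightarrow> 'n mpoint \<Rightarrow> 'n tvec set" where
  "tangent S p = {velocity c 0 | c. holo_germ S c \<and> c 0 = p}"

text \<open>The preimage of \<open>L\<close> under the differential at \<open>p\<close> of the projection \<open>proj\<close> restricted to \<open>S\<close>.\<close>

definition dproj_preimage ::
  "'n::finite mpoint set \<Rightarrow> 'n mpoint \<Rightarrow> 'n tvec set \<Rightarrow> 'n tvec set" where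
  "dproj_preimage S p L =
     {velocity c 0 | c. holo_germ S c \<and> c 0 = p \<and> velocity (proj \<circ> c) 0 \<in> L}"

definition is_line :: "'n::finite tvec set \<Rightarrow> 'n tvec set \<Rightarrow> bool" where
  "is_line D l \<longleftrightarrow> l \<subseteq> D \<and> (\<exists>v. v \<noteq> tzero \<and> l = tspan v)"

definition PD :: "'n::finite mpoint set \<Rightarrow> ('n mpoint \<Rightarrow> 'n tvec set) \<Rightarrow> 'n mpoint set" where
  "PD Z D = {Prol z l | z l. z \<in> Z \<and> is_line (D z) l}"

definition prol_dist ::
  "'n::finite mpoint set \<Rightarrow> ('n mpoint \<Rightarrow> 'n tvec set) \<Rightarrow> 'n mpoint \<Rightarrow> 'n tvec set" where
  "prol_dist Z D p = dproj_preimage (PD Z D) p (line_of p)"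

text \<open>
  The tower of a manifold \<open>F\<close>, as pairs of a space and a distribution on it. For a submanifold \<open>F\<close>
  of the \<open>i\<close>-th level which is integral for the distribution there, the inclusion of the \<open>j\<close>-th
  level of its tower in level \<open>i + j\<close> is literally an inclusion of sets.
\<close>

primrec tower ::
  "'n::finite mpoint set \<Rightarrow> nat \<Rightarrow> 'n mpoint set \<times> ('n mpoint \<Rightarrow> 'n tvec set)" where
  "tower F 0 = (F, tangent F)"
| "tower F (Suc j) = (PD (fst (tower F j)) (snd (tower F j)),
                      prol_dist (fst (tower F j)) (snd (tower F j)))"

definition monster :: "nat \<Rightarrow> 'n::finite mpoint set" where
  "monster k = fst (tower (range Base) k)"

definition Delta :: "nat \<Rightarrow> 'n::finite mpoint \<Rightarrow> 'n tvec set" where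
  "Delta k = snd (tower (range Base) k)"

definition vertical_space :: "nat \<Rightarrow> 'n::finite mpoint \<Rightarrow> 'n tvec set" where
  "vertical_space k p = dproj_preimage (monster k) p {tzero}"

definition fibre :: "nat \<Rightarrow> 'n::finite mpoint \<Rightarrow> 'n mpoint set" where
  "fibre i r = {r' \<in> monster i. proj r' = proj r}"

text \<open>For \<open>p\<close> in level \<open>i + j\<close>, the point \<open>(proj ^^ j) p\<close> is its image in level \<open>i\<close>.\<close>

definition critical_hyperplanes :: "nat \<Rightarrow> 'n::finite mpoint \<Rightarrow> 'n tvec set set" where
  "critical_hyperplanes k p =
     {snd (tower (fibre i ((proj ^^ j) p)) j) p | i j.
        1 \<le> i \<and> i + j = k \<and> p \<in> fst (tower (fibre i ((proj ^^ j) p)) j)}"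

definition regular_line :: "nat \<Rightarrow> 'n::finite mpoint \<Rightarrow> 'n tvec set \<Rightarrow> bool" where
  "regular_line k p l \<longleftrightarrow>
     is_line (Delta k p) l \<and> (\<forall>H \<in> critical_hyperplanes k p. \<not> l \<subseteq> H)"

definition vertical_line :: "nat \<Rightarrow> 'n::finite mpoint \<Rightarrow> 'n tvec set \<Rightarrow> bool" where
  "vertical_line k p l \<longleftrightarrow>
     1 \<le> k \<and> is_line (Delta k p) l \<and> l \<subseteq> vertical_space k p"

datatype rvt_letter = R | V | T

primrec rvt_code :: "'n::finite mpoint \<Rightarrow> rvt_letter list" where
  "rvt_code (Base x) = []"
| "rvt_code (Prol z l) = rvt_code z @
     [if regular_line (level z) z l then R
      else if vertical_line (level z) z l then V else T]"

definition rvt_class :: "rvt_letter list \<Rightarrow> 'n::finite mpoint set" where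
  "rvt_class w = {p \<in> monster (length w). rvt_code p = w}"

definition R_stabilization :: "rvt_letter list \<Rightarrow> 'n::finite mpoint set" where
  "R_stabilization w = (\<Union>q\<in>{1..}. rvt_class (w @ replicate q R))"

definition integral_germ ::
  "'n::finite mpoint set \<Rightarrow> ('n mpoint \<Rightarrow> 'n tvec set) \<Rightarrow> (complex \<Rightarrow> 'n mpoint) \<Rightarrow> bool" where
  "integral_germ Z D c \<longleftrightarrow> holo_germ Z c \<and> (\<forall>\<^sub>F t in nhds 0. velocity c t \<in> D (c t))"

definition regular_germ :: "nat \<Rightarrow> (complex \<Rightarrow> 'n::finite mpoint) \<Rightarrow> bool" where
  "regular_germ k c \<longleftrightarrow> integral_germ (monster k) (Delta k) c \<and>
     velocity c 0 \<noteq> tzero \<and> regular_line k (c 0) (tspan (velocity c 0))"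

text \<open>
  The germ at 0 of \<open>\<sigma>\<close> is the prolongation of the germ of \<open>\<gamma>\<close>. The velocity of a nonconstant \<open>\<gamma>\<close>
  has no zeros other than 0 in a neighbourhood of 0, and \<open>\<sigma>\<close> is continuous, being analytic in a
  chart; so \<open>\<sigma> 0\<close> is the limit of the points \<open>(\<gamma> t, span (\<gamma>' t))\<close> also when \<open>\<gamma>' 0 = 0\<close>.
\<close>

definition prolongs ::
  "'n::finite mpoint set \<Rightarrow> ('n mpoint \<Rightarrow> 'n tvec set) \<Rightarrow>
   (complex \<Rightarrow> 'n mpoint) \<Rightarrow> (complex \<Rightarrow> 'n mpoint) \<Rightarrow> bool" where
  "prolongs Z D \<gamma> \<sigma> \<longleftrightarrow>
     integral_germ Z D \<gamma> \<and> \<not> (\<forall>\<^sub>F t in nhds 0. \<gamma> t = \<gamma> 0) \<and>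
     integral_germ (PD Z D) (prol_dist Z D) \<sigma> \<and>
     (\<forall>\<^sub>F t in nhds 0. velocity \<gamma> t \<noteq> tzero \<longrightarrow> \<sigma> t = Prol (\<gamma> t) (tspan (velocity \<gamma> t)))"

primrec nth_prolongation ::
  "nat \<Rightarrow> (complex \<Rightarrow> complex ^ 'n::finite) \<Rightarrow> (complex \<Rightarrow> 'n mpoint) \<Rightarrow> bool" where
  "nth_prolongation 0 \<gamma> \<sigma> \<longleftrightarrow> \<sigma> = Base \<circ> \<gamma>"
| "nth_prolongation (Suc j) \<gamma> \<sigma> \<longleftrightarrow>
     (\<exists>\<rho>. nth_prolongation j \<gamma> \<rho> \<and> prolongs (monster j) (Delta j) \<rho> \<sigma>)"

definition Germ :: "'n::finite mpoint \<Rightarrow> (complex \<Rightarrow> complex ^ 'n) set" where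
  "Germ p = {\<gamma>. \<exists>\<sigma>. nth_prolongation (level p) \<gamma> \<sigma> \<and> \<sigma> 0 = p \<and> regular_germ (level p) \<sigma>}"

text \<open>On open sets, complex differentiability is the same as complex analyticity.\<close>

definition holo_map_on ::
  "(complex ^ 'n::finite \<Rightarrow> complex ^ 'n) \<Rightarrow> (complex ^ 'n) set \<Rightarrow> bool" where
  "holo_map_on f U \<longleftrightarrow> open U \<and>
     (\<forall>x\<in>U. \<exists>f'. (f has_derivative f') (at x) \<and> (\<forall>c v. f' (c *s v) = c *s f' v))"

definition A_even_singularity :: "nat \<Rightarrow> (complex \<Rightarrow> complex ^ 'n::finite) \<Rightarrow> bool" where
  "A_even_singularity k \<gamma> \<longleftrightarrow>
     (\<exists>\<Phi> U W \<tau> (i1::'n) (i2::'n).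
        \<gamma> 0 \<in> U \<and> bij_betw \<Phi> U W \<and> holo_map_on \<Phi> U \<and> holo_map_on (inv_into U \<Phi>) W \<and>
        \<tau> analytic_on {0} \<and> \<tau> 0 = 0 \<and> deriv \<tau> 0 \<noteq> 0 \<and>
        i1 \<noteq> i2 \<and>
        (\<forall>\<^sub>F t in nhds 0. \<gamma> (\<tau> t) \<in> U \<and>
           \<Phi> (\<gamma> (\<tau> t)) =
             (\<chi> i. if i = i1 then t ^ 2 else if i = i2 then t ^ (2 * k + 1) else 0)))"

end

theory Submission
  imports Defs "HOL-Complex_Analysis.Complex_Analysis"
begin

text \<open>
  Why the theorem holds. Let \<open>\<sigma>\<close> be the lift of \<open>\<gamma>\<close> to the level of \<open>p\<close>. A line that is not vertical
  projects onto a line, so as long as the letters are \<open>R\<close> the projections of \<open>\<sigma>\<close> remain regular germs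
  (\<open>regular_germ_proj\<close>), and one may assume that \<open>p\<close> has code \<open>R\<^sup>kV\<close> and that the lift \<open>c\<close> of \<open>\<gamma>\<close> to
  level \<open>k + 1\<close> is regular.

  All letters before the \<open>V\<close> being \<open>R\<close>, there is a coordinate \<open>x = x\<^sub>a\<close> with \<open>dx \<noteq> 0\<close> on each of the first
  \<open>k\<close> lines. The coordinates on the \<open>k\<close>-th level are then \<open>y\<^sub>0 = (x\<^sub>d)\<close> and the iterated derivatives
  \<open>y\<^sub>i\<^sub>+\<^sub>1 = dy\<^sub>i / dx\<close>. The next line is vertical: \<open>dx = 0\<close> on it, and some \<open>dy\<^sub>k\<^sub>,\<^sub>b \<noteq> 0\<close>, which gives the
  coordinate \<open>u = dx / dy\<^sub>k\<^sub>,\<^sub>b\<close>, zero at \<open>p\<close>. Regularity of \<open>c\<close> is used for two critical hyperplanes: the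
  vertical space of level \<open>k + 1\<close>, which is \<open>dy\<^sub>k\<^sub>,\<^sub>b = 0\<close>, and the prolonged fibre of level \<open>k\<close>, which is
  \<open>du = 0\<close>. So along \<open>c\<close> both \<open>y\<^sub>k\<^sub>,\<^sub>b\<close> and \<open>u\<close> have nonzero derivative at 0, and \<open>x' = u y\<^sub>k\<^sub>,\<^sub>b'\<close> vanishes
  exactly to first order.

  Hence \<open>x = x\<^sub>0 + t\<^sup>2\<close> in a suitable parameter \<open>t\<close>, and \<open>y\<^sub>i\<close> is a primitive of \<open>2 t y\<^sub>i\<^sub>+\<^sub>1\<close>. Each of
  these integrations raises the order of the odd part by two. As \<open>y\<^sub>k\<^sub>,\<^sub>b\<close> has a nonzero linear term, the
  odd part of \<open>x\<^sub>b\<close> has order exactly \<open>2 k + 1\<close>, and that of every other \<open>x\<^sub>d\<close>, \<open>d \<noteq> a\<close>, has at least this order: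
  \<open>x\<^sub>d = E\<^sub>d(t\<^sup>2) + t\<^bsup>2k+1\<^esup> G\<^sub>d(t\<^sup>2)\<close> with \<open>G\<^sub>b(0) \<noteq> 0\<close>. Since \<open>t\<^sup>2 = x - x\<^sub>0\<close> is itself a coordinate, an explicit
  triangular change of coordinates removes all \<open>E\<^sub>d\<close> and \<open>G\<^sub>d\<close>
  (\<open>A_even_singularity_criterion\<close>, \<open>A_even_singularity_normal_form\<close>).

  The other half of the work is to read off these coordinate descriptions from the definitions. There a
  tangent vector consists of its coordinates in every chart at once, so that even the dimension of
  \<open>Delta k z\<close> depends on the compatibility of all charts. The facts that are needed
  (charts are bijective, changes of charts are rational maps, and the distribution is given in a chart by
  the contact equations \<open>dy\<^sub>i\<^sub>,\<^sub>d = y\<^sub>i\<^sub>+\<^sub>1\<^sub>,\<^sub>d dy\<^sub>i\<^sub>,\<^sub>a\<close>, \<open>a\<close> being the letter of the chart for level \<open>i + 1\<close>) depend on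
  each other from level to level and are proved by one induction, \<open>good_chart\<close>. They allow any curve or line to be constructed from its coordinates in one chart;
  this is how the two critical hyperplanes are identified
  (\<open>regular_line_transverse_to_fibre\<close>, \<open>regular_line_transverse_to_prolonged_fibre\<close>).
\<close>

no_notation fps_nth (infixl "$" 75)

section \<open>Rational expressions in chart coordinates\<close>

text \<open>
  Coordinates of one chart are rational functions of those of another. Passing to the next level
  differentiates these functions along the distribution, so they are represented as syntax, on which the
  derivative is an operation that can be iterated without a notion of holomorphy in the space of all
  coordinates.
\<close>

datatype 'n rexp =
    Const complex
  | Coord nat 'n
  | Add "'n rexp" "'n rexp"
  | Mul "'n rexp" "'n rexp"
  | Inv "'n rexp"

primrec rexp_val :: "'n::finite rexp \<Rightarrow> (nat \<Rightarrow> complex ^ 'n) \<Rightarrow> complex" where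
  "rexp_val (Const c) y = c"
| "rexp_val (Coord i b) y = y i $ b"
| "rexp_val (Add e f) y = rexp_val e y + rexp_val f y"
| "rexp_val (Mul e f) y = rexp_val e y * rexp_val f y"
| "rexp_val (Inv e) y = inverse (rexp_val e y)"

primrec defined_at :: "'n::finite rexp \<Rightarrow> (nat \<Rightarrow> complex ^ 'n) \<Rightarrow> bool" where
  "defined_at (Const c) y \<longleftrightarrow> True"
| "defined_at (Coord i b) y \<longleftrightarrow> True"
| "defined_at (Add e f) y \<longleftrightarrow> defined_at e y \<and> defined_at f y"
| "defined_at (Mul e f) y \<longleftrightarrow> defined_at e y \<and> defined_at f y"
| "defined_at (Inv e) y \<longleftrightarrow> defined_at e y \<and> rexp_val e y \<noteq> 0"

text \<open>
  The coefficients \<open>D\<close> of the direction are expressions as well, because the directions of the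
  distribution vary with the point.
\<close>

primrec rexp_diff :: "(nat \<Rightarrow> 'n \<Rightarrow> 'n rexp) \<Rightarrow> 'n::finite rexp \<Rightarrow> 'n rexp" where
  "rexp_diff D (Const c) = Const 0"
| "rexp_diff D (Coord i b) = D i b"
| "rexp_diff D (Add e f) = Add (rexp_diff D e) (rexp_diff D f)"
| "rexp_diff D (Mul e f) = Add (Mul (rexp_diff D e) f) (Mul e (rexp_diff D f))"
| "rexp_diff D (Inv e) = Mul (Const (- 1)) (Mul (rexp_diff D e) (Mul (Inv e) (Inv e)))"

definition dir_deriv ::
  "(nat \<Rightarrow> complex ^ 'n) \<Rightarrow> 'n::finite rexp \<Rightarrow> (nat \<Rightarrow> complex ^ 'n) \<Rightarrow> complex" where
  "dir_deriv v e y = rexp_val (rexp_diff (\<lambda>i b. Const (v i $ b)) e) y"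

lemma defined_at_rexp_diff:
  "defined_at e y \<Longrightarrow> (\<And>i b. defined_at (D i b) y) \<Longrightarrow> defined_at (rexp_diff D e) y"
  by (induction e) auto

lemma rexp_val_diff:
  assumes "\<And>i b. rexp_val (D i b) y = v i $ b"
  shows "rexp_val (rexp_diff D e) y = dir_deriv v e y"
  unfolding dir_deriv_def by (induction e) (auto simp: assms)

lemma analytic_rexp_val:
  assumes "\<And>i b. (\<lambda>t. Y t i $ b) analytic_on {t0}" and "defined_at e (Y t0)"
  shows "(\<lambda>t. rexp_val e (Y t)) analytic_on {t0}"
  using assms(2) by (induction e) (auto intro!: analytic_intros assms(1))

lemma has_deriv_rexp_val:
  assumes "\<And>i b. ((\<lambda>t. Y t i $ b) has_field_derivative v i $ b) (at t0)"
    and "defined_at e (Y t0)"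
  shows "((\<lambda>t. rexp_val e (Y t)) has_field_derivative dir_deriv v e (Y t0)) (at t0)"
  using assms(2)
proof (induction e)
  case (Inv e)
  then have "((\<lambda>t. inverse (rexp_val e (Y t))) has_field_derivative
      - (inverse (rexp_val e (Y t0)) * dir_deriv v e (Y t0) * inverse (rexp_val e (Y t0)))) (at t0)"
    by (intro DERIV_inverse') auto
  then show ?case by (simp add: dir_deriv_def mult_ac)
next
  case (Mul e f)
  then show ?case
    using DERIV_mult[of "\<lambda>t. rexp_val e (Y t)" "dir_deriv v e (Y t0)" t0 UNIV "\<lambda>t. rexp_val f (Y t)" "dir_deriv v f (Y t0)"]
    by (simp add: dir_deriv_def mult.commute)
qed (auto simp: dir_deriv_def intro!: derivative_eq_intros assms(1))

section \<open>The contact equations in a chart\<close>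

text \<open>
  The linear space in which the chart \<open>w\<close> takes its values: each letter of \<open>w\<close> forces one copied entry to
  agree with its original.
\<close>

primrec coord_space :: "'n::finite list \<Rightarrow> (nat \<Rightarrow> complex ^ 'n) set" where
  "coord_space [] = {y. \<forall>i>0. y i = 0}"
| "coord_space (a # w) = {y. y (Suc (length w)) $ a = y (length w) $ a \<and>
     y(Suc (length w) := 0) \<in> coord_space w}"

text \<open>
  Homogeneous coordinates, normalised at \<open>a\<close>, of the line whose affine coordinates are \<open>x\<close>.
\<close>

definition affine_vec :: "'n::finite \<Rightarrow> complex ^ 'n \<Rightarrow> complex ^ 'n" where
  "affine_vec a x = (\<chi> d. if d = a then 1 else x $ d)"

text \<open>
  A vector of the distribution on the last level is determined by its components \<open>u\<close> on the highest
  coordinates: it projects to a multiple of the line that the point encodes, and \<open>u $ a\<close> is the factor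
  because the coordinate \<open>a\<close> of the last level is a copy of one of the level before. The lower
  components are found by repeating this.
\<close>

primrec contact_lift :: "'n::finite list \<Rightarrow> (nat \<Rightarrow> complex ^ 'n) \<Rightarrow> complex ^ 'n \<Rightarrow> nat \<Rightarrow> complex ^ 'n"
  where
  "contact_lift [] y u = (\<lambda>i. if i = 0 then u else 0)"
| "contact_lift (a # w) y u = (\<lambda>i. if i = Suc (length w) then u
     else u $ a *s contact_lift w y (affine_vec a (y (Suc (length w)))) i)"

text \<open>
  The same vector with expressions for entries, so that one can differentiate along it symbolically.
\<close>

primrec contact_lift_rexp :: "'n::finite list \<Rightarrow> ('n \<Rightarrow> 'n rexp) \<Rightarrow> nat \<Rightarrow> 'n \<Rightarrow> 'n rexp" where
  "contact_lift_rexp [] u = (\<lambda>i d. if i = 0 then u d else Const 0)"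
| "contact_lift_rexp (a # w) u = (\<lambda>i d. if i = Suc (length w) then u d
     else Mul (u a)
       (contact_lift_rexp w (\<lambda>d. if d = a then Const 1 else Coord (Suc (length w)) d) i d))"

lemma rexp_val_lift:
  assumes "\<And>d. rexp_val (U d) y = u $ d"
  shows "rexp_val (contact_lift_rexp w U i d) y = contact_lift w y u i $ d"
  using assms
proof (induction w arbitrary: U u)
  case (Cons a w)
  then show ?case by (auto simp: affine_vec_def)
qed auto

lemma defined_contact_lift_rexp:
  assumes "\<And>d. defined_at (U d) y"
  shows "defined_at (contact_lift_rexp w U i d) y"
  using assms by (induction w arbitrary: U) auto

lemma contact_lift_top [simp]: "contact_lift w y u (length w) = u"
  by (cases w) auto

lemma contact_lift_above: "length w < i \<Longrightarrow> contact_lift w y u i = 0"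
  by (induction w arbitrary: u) auto

lemma contact_lift_cong:
  assumes "\<And>i. i \<le> length w \<Longrightarrow> y i = y' i"
  shows "contact_lift w y u = contact_lift w y' u"
  using assms by (induction w arbitrary: u) auto

lemma contact_lift_scale: "contact_lift w y (c *s u) = (\<lambda>i. c *s contact_lift w y u i)"
  by (cases w) (auto simp: vec_eq_iff)

lemma coord_space_scale: "y \<in> coord_space w \<Longrightarrow> (\<lambda>i. c *s y i) \<in> coord_space w"
proof (induction w arbitrary: y)
  case (Cons a w)
  have "(\<lambda>i. c *s y i)(Suc (length w) := 0) = (\<lambda>i. c *s (y(Suc (length w) := 0)) i)"
    by auto
  moreover have "y(Suc (length w) := 0) \<in> coord_space w" using Cons.prems by simp
  note Cons.IH[OF this]
  ultimately have "(\<lambda>i. c *s y i)(Suc (length w) := 0) \<in> coord_space w" by metis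
  with Cons.prems show ?case by simp
qed auto

lemma coord_space_add:
  "y \<in> coord_space w \<Longrightarrow> y' \<in> coord_space w \<Longrightarrow> (\<lambda>i. y i + y' i) \<in> coord_space w"
proof (induction w arbitrary: y y')
  case (Cons a w)
  have "(\<lambda>i. y i + y' i)(Suc (length w) := 0) =
      (\<lambda>i. (y(Suc (length w) := 0)) i + (y'(Suc (length w) := 0)) i)"
    by auto
  moreover have "y(Suc (length w) := 0) \<in> coord_space w" "y'(Suc (length w) := 0) \<in> coord_space w"
    using Cons.prems by simp_all
  note Cons.IH[OF this]
  ultimately have "(\<lambda>i. y i + y' i)(Suc (length w) := 0) \<in> coord_space w" by metis
  with Cons.prems show ?case by simp
qed auto

text \<open>
  The copied coordinates agree because the normalised generator has entry 1 at the letter of the chart.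
\<close>

lemma contact_lift_in_coord_space: "contact_lift w y u \<in> coord_space w"
proof (induction w arbitrary: u)
  case (Cons a w)
  let ?x = "affine_vec a (y (Suc (length w)))"
  have "(contact_lift (a # w) y u)(Suc (length w) := 0) = (\<lambda>i. u $ a *s contact_lift w y ?x i)"
    using contact_lift_above[of w "Suc (length w)"] by auto
  moreover have "?x $ a = 1" by (simp add: affine_vec_def)
  ultimately show ?case
    using coord_space_scale[OF Cons.IH, of "u $ a" ?x] by simp
qed auto

section \<open>Charts and germs of curves\<close>

lemma in_chart_length: "in_chart w z \<Longrightarrow> length w = level z"
  by (induction w z rule: in_chart.induct) auto

lemma monster_0: "monster 0 = range Base"
  by (simp add: monster_def)

lemma monster_Suc: "monster (Suc k) = PD (monster k) (Delta k)"
  by (simp add: monster_def Delta_def)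

lemma Delta_0: "Delta 0 = tangent (range Base)"
  by (simp add: Delta_def)

lemma Delta_Suc: "Delta (Suc k) p = dproj_preimage (monster (Suc k)) p (line_of p)"
  by (simp add: monster_def Delta_def prol_dist_def)

lemma monster_level: "z \<in> monster k \<Longrightarrow> level z = k"
  by (induction k arbitrary: z) (auto simp: monster_0 monster_Suc PD_def)

lemma monster_Prol_iff:
  "Prol z l \<in> monster (Suc k) \<longleftrightarrow> z \<in> monster k \<and> is_line (Delta k z) l"
  by (auto simp: monster_Suc PD_def)

lemma monster_SucE:
  assumes "p \<in> monster (Suc k)"
  obtains z l where "p = Prol z l" "z \<in> monster k" "is_line (Delta k z) l"
  using assms by (auto simp: monster_Suc PD_def)

lemma chart_above: "length w < i \<Longrightarrow> chart w z i = 0"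
  by (induction w z rule: chart.induct) auto

lemma chart_Cons_below: "in_chart (a # w) (Prol z l) \<Longrightarrow> i \<noteq> Suc (length w) \<Longrightarrow>
    chart (a # w) (Prol z l) i = chart w z i"
  by simp

lemma chart_Cons_trunc: "(chart (a # w) (Prol z l))(Suc (length w) := 0) = chart w z"
  using chart_above[of w "Suc (length w)" z] by auto

lemma chart_in_coord_space: "in_chart w z \<Longrightarrow> chart w z \<in> coord_space w"
proof (induction w z rule: in_chart.induct)
  case (2 a w z l)
  then have "(chart (a # w) (Prol z l))(Suc (length w) := 0) \<in> coord_space w"
    by (simp only: chart_Cons_trunc in_chart.simps)
  moreover have "chart (a # w) (Prol z l) (Suc (length w)) $ a = chart (a # w) (Prol z l) (length w) $ a"
    by simp
  ultimately show ?case by (simp only: coord_space.simps mem_Collect_eq)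
qed auto

definition chart_dom :: "'n::finite list \<Rightarrow> 'n mpoint set" where
  "chart_dom w = {z \<in> monster (length w). in_chart w z}"

text \<open>
  Holomorphic germs in \<open>monster (length w)\<close>, read in one prescribed chart \<open>w\<close>; see
  \<open>holo_germ_monster_iff\<close> and \<open>holo_germ_imp_chart_germ\<close>.
\<close>

definition chart_germ :: "'n::finite list \<Rightarrow> (complex \<Rightarrow> 'n mpoint) \<Rightarrow> bool" where
  "chart_germ w c \<longleftrightarrow> (\<forall>\<^sub>F t in nhds 0. c t \<in> chart_dom w) \<and>
     (\<forall>i b. (\<lambda>t. chart w (c t) i $ b) analytic_on {0})"

lemma chart_dom_Cons:
  "Prol z l \<in> chart_dom (a # w) \<longleftrightarrow>
     z \<in> chart_dom w \<and> is_line (Delta (length w) z) l \<and> (\<exists>v\<in>l. v w (length w) $ a \<noteq> 0)"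
  by (auto simp: chart_dom_def monster_Prol_iff)

lemma chart_dom_ConsE:
  assumes "p \<in> chart_dom (a # w)"
  obtains z l where "p = Prol z l" "z \<in> chart_dom w" "is_line (Delta (length w) z) l"
  using assms by (cases p) (auto simp: chart_dom_def monster_Prol_iff)

lemma chart_dom_proj: "p \<in> chart_dom (a # w) \<Longrightarrow> proj p \<in> chart_dom w"
  by (erule chart_dom_ConsE) auto

lemma holo_germ_monster_iff:
  "holo_germ (monster k) c \<longleftrightarrow> (\<exists>w. length w = k \<and> chart_germ w c)"
proof
  assume "holo_germ (monster k) c"
  then obtain w where w: "\<forall>\<^sub>F t in nhds 0. c t \<in> monster k" "\<forall>\<^sub>F t in nhds 0. in_chart w (c t)"
    "\<And>i b. (\<lambda>t. chart w (c t) i $ b) analytic_on {0}"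
    by (auto simp: holo_germ_def)
  have len: "length w = k"
    using eventually_nhds_x_imp_x[OF w(1)] eventually_nhds_x_imp_x[OF w(2)]
    by (metis in_chart_length monster_level)
  moreover have "\<forall>\<^sub>F t in nhds 0. c t \<in> chart_dom w"
    using w(1,2) by eventually_elim (simp add: chart_dom_def len)
  ultimately show "\<exists>w. length w = k \<and> chart_germ w c"
    using w(3) by (auto simp: chart_germ_def)
next
  assume "\<exists>w. length w = k \<and> chart_germ w c"
  then obtain w where w: "length w = k" "chart_germ w c" by auto
  then have ev: "\<forall>\<^sub>F t in nhds 0. c t \<in> chart_dom w" by (simp add: chart_germ_def)
  have "\<forall>\<^sub>F t in nhds 0. c t \<in> monster k" "\<forall>\<^sub>F t in nhds 0. in_chart w (c t)"
    using ev w(1) by (auto elim!: eventually_mono simp: chart_dom_def)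
  with w(2) show "holo_germ (monster k) c"
    by (auto simp: holo_germ_def chart_germ_def)
qed

lemma chart_germ_dom: "chart_germ w c \<Longrightarrow> c 0 \<in> chart_dom w"
  by (auto simp: chart_germ_def dest: eventually_nhds_x_imp_x)

lemma chart_proj_Cons:
  assumes "p \<in> chart_dom (a # w)"
  shows "chart w (proj p) = (chart (a # w) p)(Suc (length w) := 0)"
proof -
  obtain z l where "p = Prol z l" using assms by (rule chart_dom_ConsE)
  then show ?thesis by (simp only: chart_Cons_trunc proj.simps)
qed

lemma chart_copy:
  assumes "p \<in> chart_dom (a # w)"
  shows "chart (a # w) p (Suc (length w)) $ a = chart (a # w) p (length w) $ a"
  using assms by (elim chart_dom_ConsE) simp

lemma chart_germ_proj:
  assumes "chart_germ (a # w) c"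
  shows "chart_germ w (proj \<circ> c)"
proof -
  have ev: "\<forall>\<^sub>F t in nhds 0. c t \<in> chart_dom (a # w)"
    and an: "\<And>i b. (\<lambda>t. chart (a # w) (c t) i $ b) analytic_on {0}"
    using assms by (auto simp: chart_germ_def)
  have "(\<lambda>t. chart w (proj (c t)) i $ b) analytic_on {0}" for i b
  proof (cases "i = Suc (length w)")
    case True
    then show ?thesis by (simp add: chart_above)
  next
    case False
    have "\<forall>\<^sub>F t in nhds 0. chart (a # w) (c t) i $ b = chart w (proj (c t)) i $ b"
      using ev by eventually_elim (use False in \<open>simp add: chart_proj_Cons del: chart.simps\<close>)
    then show ?thesis
      using an[of i b] by (simp add: analytic_at_cong)
  qed
  moreover have "\<forall>\<^sub>F t in nhds 0. proj (c t) \<in> chart_dom w"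
    using ev by eventually_elim (rule chart_dom_proj)
  ultimately show ?thesis by (simp add: chart_germ_def)
qed

text \<open>
  Differentiated form of the fact that a chart extends the chart below it by one row of coordinates, one
  entry of which is a copy.
\<close>

lemma velocity_proj:
  assumes ev: "\<forall>\<^sub>F s in nhds t. c s \<in> chart_dom (a # w)"
  shows "velocity (proj \<circ> c) t w = (velocity c t (a # w))(Suc (length w) := 0)"
    and "velocity c t (a # w) (Suc (length w)) $ a = velocity c t (a # w) (length w) $ a"
proof -
  have c0: "c t \<in> chart_dom (a # w)" using ev by (rule eventually_nhds_x_imp_x)
  then have dom: "in_chart (a # w) (c t)" "in_chart w (proj (c t))"
    using chart_dom_proj[OF c0] by (auto simp: chart_dom_def)
  have "deriv (\<lambda>s. chart w (proj (c s)) i $ b) t =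
      (if i = Suc (length w) then 0 else deriv (\<lambda>s. chart (a # w) (c s) i $ b) t)" for i b
  proof (cases "i = Suc (length w)")
    case True
    then show ?thesis by (simp add: chart_above)
  next
    case False
    have "\<forall>\<^sub>F s in nhds t. chart w (proj (c s)) i $ b = chart (a # w) (c s) i $ b"
      using ev by eventually_elim (use False in \<open>simp add: chart_proj_Cons del: chart.simps\<close>)
    then have "deriv (\<lambda>s. chart w (proj (c s)) i $ b) t = deriv (\<lambda>s. chart (a # w) (c s) i $ b) t"
      by (rule deriv_cong_ev) simp
    with False show ?thesis by simp
  qed
  then show "velocity (proj \<circ> c) t w = (velocity c t (a # w))(Suc (length w) := 0)"
    using dom by (auto simp: velocity_def vec_eq_iff fun_eq_iff simp del: chart.simps in_chart.simps)
  have "deriv (\<lambda>s. chart (a # w) (c s) (Suc (length w)) $ a) t =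
      deriv (\<lambda>s. chart (a # w) (c s) (length w) $ a) t"
    by (rule deriv_cong_ev) (use ev in \<open>auto elim!: eventually_mono simp: chart_copy simp del: chart.simps\<close>)
  then show "velocity c t (a # w) (Suc (length w)) $ a = velocity c t (a # w) (length w) $ a"
    using dom by (simp add: velocity_def del: chart.simps in_chart.simps)
qed

lemma velocity_chart_deriv:
  assumes "chart_germ w c"
  shows "((\<lambda>t. chart w (c t) i $ b) has_field_derivative velocity c 0 w i $ b) (at 0)"
proof -
  have "(\<lambda>t. chart w (c t) i $ b) field_differentiable at 0"
    using assms analytic_on_imp_differentiable_at[of _ "{0}" 0] by (auto simp: chart_germ_def)
  moreover have "in_chart w (c 0)"
    using chart_germ_dom[OF assms] by (simp add: chart_dom_def)
  ultimately show ?thesis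
    by (simp add: velocity_def DERIV_deriv_iff_field_differentiable)
qed

section \<open>Changes of charts\<close>

text \<open>
  The value may depend only on the rows \<open>y i\<close> with \<open>i \<le> length w\<close>. This is why \<open>y\<close> is arbitrary above
  \<open>length w\<close>: the same expressions are evaluated at points of the next level, which have one more row.
\<close>

definition rational_transition :: "'n::finite list \<Rightarrow> 'n list \<Rightarrow> (nat \<Rightarrow> 'n \<Rightarrow> 'n rexp) \<Rightarrow> bool" where
  "rational_transition w w' tr \<longleftrightarrow>
     (\<forall>z \<in> chart_dom w \<inter> chart_dom w'. \<forall>y. (\<forall>i \<le> length w. y i = chart w z i) \<longrightarrow>
        (\<forall>i b. defined_at (tr i b) y \<and> rexp_val (tr i b) y = chart w' z i $ b))"

text \<open>
  The second part says that overlaps of charts are open, as far as curves can see it.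
\<close>

definition compatible :: "'n::finite list \<Rightarrow> 'n list \<Rightarrow> bool" where
  "compatible w w' \<longleftrightarrow> (\<exists>tr. rational_transition w w' tr) \<and>
     (\<forall>c. chart_germ w c \<longrightarrow> c 0 \<in> chart_dom w' \<longrightarrow> (\<forall>\<^sub>F t in nhds 0. c t \<in> chart_dom w'))"

definition all_compatible :: "'n::finite list \<Rightarrow> bool" where
  "all_compatible w \<longleftrightarrow> (\<forall>w'. length w' = length w \<longrightarrow> compatible w w')"

lemma chart_germ_change:
  assumes "compatible w w'" "chart_germ w c" "c 0 \<in> chart_dom w'"
  shows "chart_germ w' c"
proof -
  obtain tr where tr: "rational_transition w w' tr" using assms(1) by (auto simp: compatible_def)
  have ev': "\<forall>\<^sub>F t in nhds 0. c t \<in> chart_dom w'"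
    using assms by (auto simp: compatible_def)
  have ev: "\<forall>\<^sub>F t in nhds 0. c t \<in> chart_dom w"
    using assms by (auto simp: chart_germ_def)
  have "(\<lambda>t. chart w' (c t) i $ b) analytic_on {0}" for i b
  proof -
    have "(\<lambda>t. rexp_val (tr i b) (chart w (c t))) analytic_on {0}"
      using tr chart_germ_dom[OF assms(2)] assms(2,3)
      by (intro analytic_rexp_val) (auto simp: rational_transition_def chart_germ_def)
    moreover have "\<forall>\<^sub>F t in nhds 0. rexp_val (tr i b) (chart w (c t)) = chart w' (c t) i $ b"
      using ev ev' by eventually_elim (use tr in \<open>auto simp: rational_transition_def\<close>)
    ultimately show ?thesis by (simp add: analytic_at_cong)
  qed
  with ev' show ?thesis by (simp add: chart_germ_def)
qed

lemma velocity_above: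
  assumes "length w < i"
  shows "velocity c t w i = 0"
  using assms by (simp add: velocity_def chart_above vec_eq_iff)

text \<open>
  Chain rule. The rows of \<open>y\<close> above \<open>length w\<close> are constant along the curve \<open>Y\<close> used in the proof, and so
  do not contribute.
\<close>

lemma velocity_change:
  assumes "compatible w w'" "rational_transition w w' tr" "chart_germ w c" "c 0 \<in> chart_dom w'"
    and y: "\<And>i. i \<le> length w \<Longrightarrow> y i = chart w (c 0) i"
  shows "velocity c 0 w' i $ b = dir_deriv (velocity c 0 w) (tr i b) y"
proof -
  have g': "chart_germ w' c" using assms by (blast intro: chart_germ_change)
  have ev: "\<forall>\<^sub>F t in nhds 0. c t \<in> chart_dom w" "\<forall>\<^sub>F t in nhds 0. c t \<in> chart_dom w'"
    using assms(3) g' by (auto simp: chart_germ_def)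
  define Y where "Y t i = (if i \<le> length w then chart w (c t) i else y i)" for t i
  have Y0: "Y 0 = y" using y by (auto simp: Y_def)
  have "((\<lambda>t. rexp_val (tr i b) (Y t)) has_field_derivative
      dir_deriv (velocity c 0 w) (tr i b) (Y 0)) (at 0)"
  proof (rule has_deriv_rexp_val)
    show "((\<lambda>t. Y t i $ b) has_field_derivative velocity c 0 w i $ b) (at 0)" for i b
      using velocity_chart_deriv[OF assms(3), of i b]
      by (cases "i \<le> length w") (auto simp: Y_def velocity_above)
    show "defined_at (tr i b) (Y 0)"
      using assms(2,4) chart_germ_dom[OF assms(3)] y by (simp add: rational_transition_def Y0)
  qed
  moreover have "\<forall>\<^sub>F t in nhds 0. rexp_val (tr i b) (Y t) = chart w' (c t) i $ b"
    using ev by eventually_elim (use assms(2) in \<open>auto simp: rational_transition_def Y_def\<close>)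
  ultimately have "((\<lambda>t. chart w' (c t) i $ b) has_field_derivative
      dir_deriv (velocity c 0 w) (tr i b) y) (at 0)"
    by (simp add: DERIV_cong_ev Y0)
  with velocity_chart_deriv[OF g'] show ?thesis by (rule DERIV_unique)
qed

lemma all_compatibleD:
  "all_compatible w \<Longrightarrow> in_chart w' z \<Longrightarrow> z \<in> chart_dom w \<Longrightarrow> compatible w w' \<and> z \<in> chart_dom w'"
  unfolding all_compatible_def chart_dom_def
  using in_chart_length monster_level by (metis (no_types, lifting) mem_Collect_eq)

text \<open>
  By the chain rule the velocity in one chart determines those in all others.
\<close>

lemma velocity_eqI:
  assumes "all_compatible w" "chart_germ w c" "chart_germ w c'" "c 0 = c' 0"
    and "velocity c 0 w = velocity c' 0 w"
  shows "velocity c 0 = velocity c' 0"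
proof (intro ext)
  fix w' i
  show "velocity c 0 w' i = velocity c' 0 w' i"
  proof (cases "in_chart w' (c 0)")
    case True
    then have *: "compatible w w'" "c 0 \<in> chart_dom w'"
      using all_compatibleD chart_germ_dom assms by blast+
    then obtain tr where "rational_transition w w' tr" by (auto simp: compatible_def)
    then show ?thesis
      using velocity_change[OF *(1), where y = "chart w (c 0)"] * assms
      by (simp add: vec_eq_iff)
  next
    case False
    then show ?thesis using assms(4) by (simp add: velocity_def)
  qed
qed

lemma chart_germ_rescale:
  assumes "chart_germ w c"
  shows "chart_germ w (\<lambda>t. c (r * t))"
proof -
  have lim: "((\<lambda>t. r * t) \<longlongrightarrow> 0) (nhds 0)"
    using tendsto_mult[OF tendsto_const filterlim_ident[of "nhds (0::complex)"], of r] by simp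
  have "\<forall>\<^sub>F t in nhds 0. c (r * t) \<in> chart_dom w"
    using assms lim by (auto simp: chart_germ_def dest: eventually_compose_filterlim)
  moreover have "(\<lambda>t. chart w (c (r * t)) i $ b) analytic_on {0}" for i b
    using analytic_on_compose_gen[of "\<lambda>t. r * t" "{0}" "\<lambda>t. chart w (c t) i $ b" "{0}"] assms
    by (auto simp: chart_germ_def o_def intro!: analytic_intros)
  ultimately show ?thesis by (simp add: chart_germ_def)
qed

text \<open>
  Provides scalar multiples of velocities in all charts at once; this is what makes \<open>Delta\<close> closed under
  scaling.
\<close>

lemma velocity_rescale:
  assumes "all_compatible w" "chart_germ w c"
  shows "velocity (\<lambda>t. c (r * t)) 0 = (\<lambda>w' i. r *s velocity c 0 w' i)"
proof (intro ext)
  fix w' i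
  show "velocity (\<lambda>t. c (r * t)) 0 w' i = r *s velocity c 0 w' i"
  proof (cases "in_chart w' (c 0)")
    case True
    then have *: "compatible w w'" "c 0 \<in> chart_dom w'"
      using all_compatibleD chart_germ_dom assms by blast+
    have g: "chart_germ w' c" using * assms by (blast intro: chart_germ_change)
    have "velocity (\<lambda>t. c (r * t)) 0 w' i $ b = r * velocity c 0 w' i $ b" for b
    proof -
      have "((\<lambda>t. chart w' (c t) i $ b) has_field_derivative velocity c 0 w' i $ b) (at (r * 0))"
        using velocity_chart_deriv[OF g, of i b] by simp
      moreover have "((\<lambda>t. r * t) has_field_derivative r) (at 0)"
        by (auto intro!: derivative_eq_intros)
      ultimately have "((\<lambda>t. chart w' (c (r * t)) i $ b) has_field_derivative
          velocity c 0 w' i $ b * r) (at 0)"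
        by (rule DERIV_chain2)
      then show ?thesis
        using velocity_chart_deriv[OF chart_germ_rescale[OF g], of r i b]
        by (metis DERIV_unique mult.commute)
    qed
    then show ?thesis by (simp add: vec_eq_iff)
  next
    case False
    then show ?thesis by (simp add: velocity_def)
  qed
qed

section \<open>Curves that are straight in a chart\<close>

definition chart_bij :: "'n::finite list \<Rightarrow> bool" where
  "chart_bij w \<longleftrightarrow> bij_betw (chart w) (chart_dom w) (coord_space w)"

definition straight_curve :: "'n::finite list \<Rightarrow> 'n mpoint \<Rightarrow> (nat \<Rightarrow> complex ^ 'n) \<Rightarrow> complex \<Rightarrow> 'n mpoint"
  where "straight_curve w z e t = inv_into (chart_dom w) (chart w) (\<lambda>i. chart w z i + t *s e i)"

lemma chart_eqD:
  "chart_bij w \<Longrightarrow> z \<in> chart_dom w \<Longrightarrow> z' \<in> chart_dom w \<Longrightarrow> chart w z = chart w z' \<Longrightarrow> z = z'"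
  by (auto simp: chart_bij_def bij_betw_def dest: inj_onD)

lemma chart_dom_coord: "z \<in> chart_dom w \<Longrightarrow> chart w z \<in> coord_space w"
  by (simp add: chart_dom_def chart_in_coord_space)

lemma straight_curve:
  assumes "chart_bij w" "z \<in> chart_dom w" "e \<in> coord_space w"
  shows chart_straight: "chart w (straight_curve w z e t) = (\<lambda>i. chart w z i + t *s e i)"
    and straight_dom: "straight_curve w z e t \<in> chart_dom w"
    and straight_0: "straight_curve w z e 0 = z"
    and chart_germ_straight: "chart_germ w (straight_curve w z e)"
    and velocity_straight: "velocity (straight_curve w z e) 0 w = e"
proof -
  have "(\<lambda>i. chart w z i + t *s e i) \<in> coord_space w" for t
    by (intro coord_space_add coord_space_scale chart_dom_coord assms)
  then have im: "(\<lambda>i. chart w z i + t *s e i) \<in> chart w ` chart_dom w" for t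
    using assms(1) by (simp add: chart_bij_def bij_betw_def)
  have ch: "chart w (straight_curve w z e t) = (\<lambda>i. chart w z i + t *s e i)" for t
    unfolding straight_curve_def by (rule f_inv_into_f[OF im])
  then show "chart w (straight_curve w z e t) = (\<lambda>i. chart w z i + t *s e i)" .
  have dom: "straight_curve w z e t \<in> chart_dom w" for t
    unfolding straight_curve_def by (rule inv_into_into[OF im])
  then show "straight_curve w z e t \<in> chart_dom w" .
  show "straight_curve w z e 0 = z"
    by (rule chart_eqD[OF assms(1) dom assms(2)]) (simp add: ch)
  show g: "chart_germ w (straight_curve w z e)"
    unfolding chart_germ_def by (auto simp: ch dom intro!: analytic_intros)
  have "velocity (straight_curve w z e) 0 w i $ b = e i $ b" for i b
  proof (rule DERIV_unique[OF velocity_chart_deriv[OF g]])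
    show "((\<lambda>t. chart w (straight_curve w z e t) i $ b) has_field_derivative e i $ b) (at 0)"
      by (auto simp: ch intro!: derivative_eq_intros)
  qed
  then show "velocity (straight_curve w z e) 0 w = e" by (simp add: vec_eq_iff fun_eq_iff)
qed

section \<open>The distribution in a chart\<close>

definition contact_germ :: "'n::finite list \<Rightarrow> (complex \<Rightarrow> 'n mpoint) \<Rightarrow> bool" where
  "contact_germ w c \<longleftrightarrow> chart_germ w c \<and>
     velocity c 0 w = contact_lift w (chart w (c 0)) (velocity c 0 w (length w))"

text \<open>
  The distribution is given by the contact equations. It is described through germs and not through the
  vectors alone, because only velocities of germs transform correctly between charts.
\<close>

definition Delta_is_contact :: "'n::finite list \<Rightarrow> bool" where
  "Delta_is_contact w \<longleftrightarrow> (\<forall>z \<in> chart_dom w.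
     Delta (length w) z = {velocity c 0 | c. contact_germ w c \<and> c 0 = z})"

text \<open>
  What has to be known about the charts of one level in order to construct those of the next.
\<close>

definition good_chart :: "'n::finite list \<Rightarrow> bool" where
  "good_chart w \<longleftrightarrow> chart_bij w \<and> all_compatible w \<and> Delta_is_contact w"

lemma Delta_E:
  assumes "good_chart w" "z \<in> chart_dom w" "v \<in> Delta (length w) z"
  obtains c where "chart_germ w c" "c 0 = z" "v = velocity c 0"
    "v w = contact_lift w (chart w z) (v w (length w))"
  using assms unfolding good_chart_def Delta_is_contact_def contact_germ_def by force

lemma Delta_I:
  assumes "good_chart w" "chart_germ w c" "v = velocity c 0"
    and "v w = contact_lift w (chart w (c 0)) (v w (length w))"
  shows "v \<in> Delta (length w) (c 0)"
  using assms chart_germ_dom[OF assms(2)]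
  unfolding good_chart_def Delta_is_contact_def contact_germ_def by force

lemma Delta_lift:
  assumes "good_chart w" "z \<in> chart_dom w" "v \<in> Delta (length w) z"
  shows "v w = contact_lift w (chart w z) (v w (length w))"
  using assms by (elim Delta_E)

text \<open>
  The contact equations give the lower components in the chart \<open>w\<close>, and compatibility of charts those in
  the other charts.
\<close>

lemma Delta_eqI:
  assumes "good_chart w" "z \<in> chart_dom w" "v \<in> Delta (length w) z" "v' \<in> Delta (length w) z"
    and "v w (length w) = v' w (length w)"
  shows "v = v'"
proof -
  have vv: "v w = v' w"
    using Delta_lift[OF assms(1,2)] assms(3-5) by metis
  obtain c where "chart_germ w c" "c 0 = z" "v = velocity c 0"
    using Delta_E[OF assms(1-3)] by metis
  moreover obtain c' where "chart_germ w c'" "c' 0 = z" "v' = velocity c' 0"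
    using Delta_E[OF assms(1,2,4)] by metis
  ultimately show ?thesis
    using assms(1) vv by (auto simp: good_chart_def intro: velocity_eqI)
qed

lemma Delta_scale:
  assumes "good_chart w" "z \<in> chart_dom w" "v \<in> Delta (length w) z"
  shows "(\<lambda>w' i. r *s v w' i) \<in> Delta (length w) z"
proof -
  obtain c where c: "chart_germ w c" "c 0 = z" "v = velocity c 0"
    "v w = contact_lift w (chart w z) (v w (length w))"
    using Delta_E[OF assms] by metis
  let ?c = "\<lambda>t. c (r * t)"
  have vel: "velocity ?c 0 = (\<lambda>w' i. r *s v w' i)"
    using velocity_rescale[OF _ c(1)] assms(1) c(3) by (simp add: good_chart_def)
  have "velocity ?c 0 \<in> Delta (length w) (?c 0)"
  proof (rule Delta_I[OF assms(1) chart_germ_rescale[OF c(1)] refl])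
    have "(\<lambda>i. r *s v w i) = contact_lift w (chart w z) (r *s v w (length w))"
      by (subst c(4)) (simp add: contact_lift_scale)
    then show "velocity ?c 0 w = contact_lift w (chart w (?c 0)) (velocity ?c 0 w (length w))"
      unfolding vel using c(2) by simp
  qed
  then show ?thesis using vel c(2) by simp
qed

lemma Delta_ex:
  assumes "good_chart w" "z \<in> chart_dom w"
  obtains v where "v \<in> Delta (length w) z" "v w (length w) = u" "v w = contact_lift w (chart w z) u"
proof -
  let ?c = "straight_curve w z (contact_lift w (chart w z) u)"
  have b: "chart_bij w" using assms by (simp add: good_chart_def)
  note s = straight_0[OF b assms(2) contact_lift_in_coord_space] velocity_straight[OF b assms(2) contact_lift_in_coord_space]
  have "velocity ?c 0 \<in> Delta (length w) (?c 0)"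
    by (rule Delta_I[OF assms(1) chart_germ_straight[OF b assms(2) contact_lift_in_coord_space] refl])
      (simp add: s)
  then show ?thesis using that[of "velocity ?c 0"] by (simp add: s)
qed

lemma tspan_self: "v \<in> tspan v"
proof -
  have "v = (\<lambda>w i. 1 *s v w i)" by simp
  then show ?thesis unfolding tspan_def by blast
qed

lemma tspan_E:
  assumes "v \<in> tspan v0" obtains r where "v = (\<lambda>w i. r *s v0 w i)"
  using assms by (auto simp: tspan_def)

lemma tspan_scale:
  assumes "r \<noteq> 0"
  shows "tspan (\<lambda>w i. r *s v w i) = tspan v"
proof -
  have "(\<lambda>w i. c *s v w i) = (\<lambda>w i. (c / r) *s (r *s v w i))" for c using assms by simp
  moreover have "(\<lambda>w i. c *s (r *s v w i)) = (\<lambda>w i. (c * r) *s v w i)" for c by simp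
  ultimately show ?thesis unfolding tspan_def by blast
qed

lemma line_eq_tspan:
  assumes "is_line D l" "v \<in> l" "v \<noteq> tzero"
  shows "l = tspan v"
proof -
  obtain v0 where "l = tspan v0" using assms(1) by (auto simp: is_line_def)
  moreover obtain r where "v = (\<lambda>w i. r *s v0 w i)"
    using assms(2) calculation by (auto elim: tspan_E)
  moreover have "r \<noteq> 0" using assms(3) calculation(2) by (auto simp: tzero_def)
  ultimately show ?thesis by (simp add: tspan_scale)
qed

lemma is_line_tspan:
  assumes "good_chart w" "z \<in> chart_dom w" "v \<in> Delta (length w) z" "v \<noteq> tzero"
  shows "is_line (Delta (length w) z) (tspan v)"
  using Delta_scale[OF assms(1-3)] assms(4) by (auto simp: is_line_def tspan_def)

lemma chart_Cons_top:
  assumes dom: "Prol z (tspan v) \<in> chart_dom (a # w)"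
  shows "chart (a # w) (Prol z (tspan v)) (Suc (length w)) $ b =
    (if b = a then chart w z (length w) $ a else v w (length w) $ b / v w (length w) $ a)"
    and "v w (length w) $ a \<noteq> 0"
proof -
  show nz: "v w (length w) $ a \<noteq> 0"
    using dom by (auto simp: chart_dom_Cons tspan_def)
  have "(THE u. \<forall>v'\<in>tspan v. v' w (length w) $ b = u * v' w (length w) $ a) =
      v w (length w) $ b / v w (length w) $ a"
  proof (rule the_equality)
    show "\<forall>v'\<in>tspan v. v' w (length w) $ b
        = v w (length w) $ b / v w (length w) $ a * v' w (length w) $ a"
      using nz by (auto simp: tspan_def)
    fix u assume "\<forall>v'\<in>tspan v. v' w (length w) $ b = u * v' w (length w) $ a"
    then have "v w (length w) $ b = u * v w (length w) $ a" using tspan_self by blast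
    then show "u = v w (length w) $ b / v w (length w) $ a" using nz by simp
  qed
  then show "chart (a # w) (Prol z (tspan v)) (Suc (length w)) $ b =
    (if b = a then chart w z (length w) $ a else v w (length w) $ b / v w (length w) $ a)"
    by simp
qed

text \<open>
  The entries of the last row of a point are the components of a suitably normalised vector on its line.
\<close>

lemma line_generator:
  assumes "good_chart w" "Prol z l \<in> chart_dom (a # w)"
  obtains v where "v \<in> Delta (length w) z" "l = tspan v"
    "v w (length w) = affine_vec a (chart (a # w) (Prol z l) (Suc (length w)))"
    "v w = contact_lift w (chart w z) (affine_vec a (chart (a # w) (Prol z l) (Suc (length w))))"
proof -
  have z: "z \<in> chart_dom w" "is_line (Delta (length w) z) l"
    using assms(2) by (auto simp: chart_dom_Cons)
  then obtain v0 where v0: "l = tspan v0" "v0 \<in> Delta (length w) z"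
    using tspan_self by (auto simp: is_line_def)
  have dom: "Prol z (tspan v0) \<in> chart_dom (a # w)" using assms(2) v0 by simp
  define r where "r = inverse (v0 w (length w) $ a)"
  have nz: "v0 w (length w) $ a \<noteq> 0" by (rule chart_Cons_top(2)[OF dom])
  let ?v = "\<lambda>w i. r *s v0 w i"
  have "l = tspan ?v" using nz by (simp add: v0 r_def tspan_scale)
  moreover have D: "?v \<in> Delta (length w) z" by (rule Delta_scale[OF assms(1) z(1) v0(2)])
  moreover have top: "?v w (length w) = affine_vec a (chart (a # w) (Prol z l) (Suc (length w)))"
    unfolding v0(1) using nz
    by (simp add: vec_eq_iff affine_vec_def chart_Cons_top(1)[OF dom] r_def field_simps del: chart.simps)
  ultimately show ?thesis using that[of ?v] Delta_lift[OF assms(1) z(1) D] by metis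
qed

section \<open>Prolonging charts\<close>

text \<open>
  A line is recovered from its coordinates since the distribution is isomorphic to \<open>\<complex>\<^sup>n\<close> via the highest
  row, where injectivity is \<open>Delta_eqI\<close> and surjectivity is \<open>Delta_ex\<close>.
\<close>

lemma chart_bij_Cons:
  assumes g: "good_chart w"
  shows "chart_bij (a # w)"
  unfolding chart_bij_def bij_betw_def
proof (intro conjI inj_onI set_eqI iffI)
  let ?n = "Suc (length w)"
  have b: "chart_bij w" using g by (simp add: good_chart_def)
  fix p p' assume p: "p \<in> chart_dom (a # w)" "p' \<in> chart_dom (a # w)"
    and eq: "chart (a # w) p = chart (a # w) p'"
  obtain z l z' l' where pz: "p = Prol z l" "p' = Prol z' l'" "z \<in> chart_dom w" "z' \<in> chart_dom w"
    using p by (elim chart_dom_ConsE)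
  have "chart w z = chart w z'"
    using eq by (metis pz(1,2) chart_Cons_trunc)
  then have zz: "z' = z" using chart_eqD[OF b] pz by blast
  obtain v where v: "v \<in> Delta (length w) z" "l = tspan v"
    "v w (length w) = affine_vec a (chart (a # w) p ?n)"
    using line_generator[OF g] p(1) unfolding pz(1) by metis
  obtain v' where v': "v' \<in> Delta (length w) z" "l' = tspan v'"
    "v' w (length w) = affine_vec a (chart (a # w) p' ?n)"
    using line_generator[OF g] p(2) unfolding pz(2) zz by metis
  have "v = v'"
    by (rule Delta_eqI[OF g pz(3) v(1) v'(1)]) (simp only: v(3) v'(3) eq)
  then show "p = p'" using v v' pz zz by simp
next
  fix y assume "y \<in> chart (a # w) ` chart_dom (a # w)"
  then show "y \<in> coord_space (a # w)" by (auto simp del: chart.simps coord_space.simps intro: chart_dom_coord)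
next
  let ?n = "Suc (length w)"
  fix y assume y: "y \<in> coord_space (a # w)"
  then have y': "y(?n := 0) \<in> coord_space w" "y ?n $ a = y (length w) $ a" by simp_all
  have "chart w ` chart_dom w = coord_space w"
    using g by (simp add: good_chart_def chart_bij_def bij_betw_def)
  then obtain z where z: "z \<in> chart_dom w" "y(?n := 0) = chart w z"
    using y'(1) by (metis imageE)
  obtain v where v: "v \<in> Delta (length w) z" "v w (length w) = affine_vec a (y ?n)"
    by (rule Delta_ex[OF g z(1)])
  have va: "v w (length w) $ a = 1" by (simp add: v affine_vec_def)
  then have "v \<noteq> tzero" by (auto simp: tzero_def)
  then have "is_line (Delta (length w) z) (tspan v)" by (rule is_line_tspan[OF g z(1) v(1)])
  moreover have "\<exists>v'\<in>tspan v. v' w (length w) $ a \<noteq> 0" using va by (intro bexI[OF _ tspan_self]) simp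
  ultimately have dom: "Prol z (tspan v) \<in> chart_dom (a # w)"
    using z(1) by (simp add: chart_dom_Cons)
  have "chart (a # w) (Prol z (tspan v)) i = y i" for i
  proof (cases "i = ?n")
    case True
    have "chart w z (length w) = y (length w)" unfolding z(2)[symmetric] by simp
    with True show ?thesis
      using va y'(2) by (simp add: vec_eq_iff chart_Cons_top(1)[OF dom] v affine_vec_def del: chart.simps)
  next
    case False
    then have "chart (a # w) (Prol z (tspan v)) i = chart w z i" by simp
    also have "\<dots> = y i" unfolding z(2)[symmetric] using False by simp
    finally show ?thesis .
  qed
  then have "chart (a # w) (Prol z (tspan v)) = y" by (intro ext)
  with dom show "y \<in> chart (a # w) ` chart_dom (a # w)" by (metis imageI)
qed

text \<open>
  The new coordinates in the chart \<open>a' # w'\<close> are quotients of components of a vector spanning the line.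
  In the chart \<open>a # w\<close> this vector is the contact lift of the affine coordinates, and its components in
  \<open>w'\<close> are the derivatives of the old transition functions along it. So the new transition functions are
  again rational, and the new chart domain is where a denominator does not vanish.
\<close>

lemma compatible_Cons:
  assumes g: "good_chart w" and len: "length w' = length w"
  shows "compatible (a # w) (a' # w')"
proof -
  let ?n = "Suc (length w)"
  have comp: "compatible w w'" using g len by (simp add: good_chart_def all_compatible_def)
  then obtain tr where tr: "rational_transition w w' tr" by (auto simp: compatible_def)
  define N where "N b = rexp_diff (contact_lift_rexp w (\<lambda>d. if d = a then Const 1 else Coord ?n d)) (tr (length w) b)" for b
  \<comment> \<open>old rows as before; in the new row, entry \<open>a'\<close> is the copy and the others are quotients\<close>
  define tr' where "tr' i b = (if i \<le> length w then tr i b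
      else if i > ?n then Const 0
      else if b = a' then tr (length w) a' else Mul (N b) (Inv (N a')))" for i b
  \<comment> \<open>\<open>N\<close> gives the top components in \<open>w'\<close> of the generator of \<open>l\<close> that is normalised in \<open>w\<close>\<close>
  have N: "defined_at (N b) y \<and> (\<exists>v. l = tspan v \<and> (\<forall>b. rexp_val (N b) y = v w' (length w) $ b))"
    if p: "Prol z l \<in> chart_dom (a # w)" and z: "z \<in> chart_dom w'"
      and y: "\<And>i. i \<le> ?n \<Longrightarrow> y i = chart (a # w) (Prol z l) i" for z l b y
  proof -
    have zw: "z \<in> chart_dom w" using p by (simp add: chart_dom_Cons)
    obtain v where v: "v \<in> Delta (length w) z" "l = tspan v"
      "v w = contact_lift w (chart w z) (affine_vec a (chart (a # w) (Prol z l) ?n))"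
      using line_generator[OF g p] by metis
    have yw: "y i = chart w z i" if "i \<le> length w" for i
      using y[of i] that by (simp add: chart_Cons_below)
    have vlift: "v w = contact_lift w y (affine_vec a (y ?n))"
      using y[of ?n] yw by (metis v(3) contact_lift_cong le_refl)
    obtain c where c: "chart_germ w c" "c 0 = z" "v = velocity c 0"
      using Delta_E[OF g zw v(1)] by metis
    have d: "defined_at (tr (length w) b) y" for b
      using tr zw z yw by (simp add: rational_transition_def)
    have "v w' (length w) $ b = rexp_val (N b) y" for b
    proof -
      have "v w' (length w) $ b = dir_deriv (v w) (tr (length w) b) y"
        using velocity_change[OF comp tr c(1), where y = y] c z yw by simp
      also have "\<dots> = rexp_val (N b) y"
        unfolding N_def vlift
        by (rule rexp_val_diff[symmetric], rule rexp_val_lift) (simp add: affine_vec_def)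
      finally show ?thesis .
    qed
    moreover have "defined_at (N b) y"
      unfolding N_def by (intro defined_at_rexp_diff d defined_contact_lift_rexp) simp
    ultimately show ?thesis using v(2) by auto
  qed
  have tr': "defined_at (tr' i b) y \<and> rexp_val (tr' i b) y = chart (a' # w') p i $ b"
    if p: "p \<in> chart_dom (a # w)" "p \<in> chart_dom (a' # w')"
      and y: "\<And>i. i \<le> ?n \<Longrightarrow> y i = chart (a # w) p i" for p y i b
  proof -
    obtain z l where pz: "p = Prol z l" using p(1) by (rule chart_dom_ConsE)
    have z: "z \<in> chart_dom w" "z \<in> chart_dom w'"
      using p by (auto simp: pz chart_dom_Cons)
    obtain v where v: "l = tspan v" "\<And>b. rexp_val (N b) y = v w' (length w) $ b"
      and d: "\<And>b. defined_at (N b) y"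
      using N[OF p(1)[unfolded pz] z(2), of y] y unfolding pz by metis
    have old: "defined_at (tr i b) y \<and> rexp_val (tr i b) y = chart w' z i $ b" for i b
    proof -
      have "y i = chart w z i" if "i \<le> length w" for i
        using y[of i] that by (simp add: pz)
      then show ?thesis using tr z by (simp add: rational_transition_def)
    qed
    note top = chart_Cons_top[OF p(2)[unfolded pz v(1)], unfolded len]
    consider "i \<le> length w" | "i = ?n" | "i > ?n" by linarith
    then show ?thesis
    proof cases
      case 1
      then show ?thesis using old[of i b] by (simp add: tr'_def pz len)
    next
      case 2
      then show ?thesis using old[of "length w" a'] top(1)[of b] top(2) v d
        by (simp add: tr'_def pz len divide_inverse del: chart.simps)
    next
      case 3
      then show ?thesis using chart_above[of "a' # w'" i p] len
        by (simp add: tr'_def del: chart.simps)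
    qed
  qed
  have "\<forall>\<^sub>F t in nhds 0. c t \<in> chart_dom (a' # w')"
    if c: "chart_germ (a # w) c" and c0: "c 0 \<in> chart_dom (a' # w')" for c
  proof -
    have ev: "\<forall>\<^sub>F t in nhds 0. c t \<in> chart_dom (a # w)" using c by (simp add: chart_germ_def)
    have gp: "chart_germ w' (proj \<circ> c)"
      using chart_germ_change[OF comp chart_germ_proj[OF c]] chart_dom_proj[OF c0] by simp
    let ?f = "\<lambda>t. rexp_val (N a') (chart (a # w) (c t))"
    have top_coord: "defined_at (N a') (chart (a # w) p) \<and>
        (p \<in> chart_dom (a' # w') \<longleftrightarrow> rexp_val (N a') (chart (a # w) p) \<noteq> 0)"
      if p: "p \<in> chart_dom (a # w)" and z: "proj p \<in> chart_dom w'" for p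
    proof -
      obtain z l where pz: "p = Prol z l" using p(1) by (rule chart_dom_ConsE)
      obtain v where v: "l = tspan v" "\<And>b. rexp_val (N b) (chart (a # w) p) = v w' (length w) $ b"
        and d: "defined_at (N a') (chart (a # w) p)"
        using N[of z l "chart (a # w) p"] p z unfolding pz proj.simps by metis
      have "(\<exists>v'\<in>tspan v. v' w' (length w) $ a' \<noteq> 0) \<longleftrightarrow> v w' (length w) $ a' \<noteq> 0"
        using tspan_self[of v] by (auto simp: tspan_def)
      moreover have "is_line (Delta (length w) z) l" using p by (simp add: pz chart_dom_Cons)
      ultimately show ?thesis using z d
        by (simp add: v(2) del: chart.simps) (simp add: pz chart_dom_Cons len v(1))
    qed
    have "c 0 \<in> chart_dom (a # w)" "proj (c 0) \<in> chart_dom w'"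
      using chart_germ_dom[OF c] chart_dom_proj[OF c0] by simp_all
    note at_0 = top_coord[OF this]
    have "?f analytic_on {0}"
      using c at_0 by (intro analytic_rexp_val) (auto simp: chart_germ_def simp del: chart.simps)
    then have "(?f \<longlongrightarrow> ?f 0) (at 0)"
      using analytic_at_imp_isCont isCont_def by blast
    moreover have nz: "?f 0 \<noteq> 0" using at_0 c0 by blast
    ultimately have "\<forall>\<^sub>F t in at 0. ?f t \<noteq> 0" by (rule tendsto_imp_eventually_ne)
    then have "\<forall>\<^sub>F t in nhds 0. ?f t \<noteq> 0"
      using nz unfolding eventually_nhds_conv_at by blast
    moreover have "\<forall>\<^sub>F t in nhds 0. proj (c t) \<in> chart_dom w'"
      using gp by (simp add: chart_germ_def)
    ultimately show ?thesis using ev by eventually_elim (use top_coord in blast)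
  qed
  moreover have "rational_transition (a # w) (a' # w') tr'"
    unfolding rational_transition_def
  proof (intro ballI allI impI)
    fix p y i b
    assume "p \<in> chart_dom (a # w) \<inter> chart_dom (a' # w')"
      "\<forall>i\<le>length (a # w). y i = chart (a # w) p i"
    then show "defined_at (tr' i b) y \<and> rexp_val (tr' i b) y = chart (a' # w') p i $ b"
      by (intro tr') (simp_all del: chart.simps)
  qed
  ultimately show ?thesis unfolding compatible_def by blast
qed

text \<open>
  The definition of \<open>Delta\<close> on the new level asks that the projected velocity lie on the given line, which
  by \<open>line_generator\<close> is spanned by the vector that also appears in \<open>contact_lift\<close>. Conversely, a curve
  whose velocity has the right coordinates in one chart projects to a velocity that agrees with one on the
  line in the chart below, hence in all charts.
\<close>

lemma Delta_is_contact_Cons: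
  assumes g: "good_chart w"
    and comp: "\<And>w'. length w' = length (a # w) \<Longrightarrow> compatible w' (a # w)"
  shows "Delta_is_contact (a # w)"
  unfolding Delta_is_contact_def
proof (intro ballI set_eqI iffI)
  let ?n = "Suc (length w)"
  fix p v assume p: "p \<in> chart_dom (a # w)"
  obtain z l where pz: "p = Prol z l" "z \<in> chart_dom w" "is_line (Delta (length w) z) l"
    using p by (rule chart_dom_ConsE)
  obtain v0 where v0: "v0 \<in> Delta (length w) z" "l = tspan v0"
    "v0 w = contact_lift w (chart w z) (affine_vec a (chart (a # w) p ?n))"
    using line_generator[OF g p[unfolded pz(1)]] unfolding pz(1) by metis
  have v0': "v0 w = contact_lift w (chart (a # w) p) (affine_vec a (chart (a # w) p ?n))"
    using v0(3) contact_lift_cong[of w "chart (a # w) p" "chart w z"] by (simp add: pz(1))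
  {
    assume "v \<in> Delta (length (a # w)) p"
    then obtain c where c: "holo_germ (monster ?n) c" "c 0 = p" "velocity (proj \<circ> c) 0 \<in> l"
      "v = velocity c 0"
      by (auto simp: Delta_Suc dproj_preimage_def pz(1))
    obtain w' where "length w' = ?n" "chart_germ w' c"
      using c(1) by (auto simp: holo_germ_monster_iff)
    moreover have "compatible w' (a # w)" using calculation(1) by (simp add: comp)
    ultimately have cg: "chart_germ (a # w) c"
      using chart_germ_change c(2) p by blast
    obtain r where r: "velocity (proj \<circ> c) 0 = (\<lambda>w i. r *s v0 w i)"
      using c(3) v0(2) by (auto elim: tspan_E)
    have ev: "\<forall>\<^sub>F t in nhds 0. c t \<in> chart_dom (a # w)" using cg by (simp add: chart_germ_def)
    note vp = velocity_proj[OF ev]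
    have low: "v (a # w) i = r *s v0 w i" if "i \<noteq> ?n" for i
      using fun_cong[OF vp(1), of i] that r c(4) by simp
    have "r = v (a # w) ?n $ a"
      using vp(2) low[of "length w"] c(4) v0' by (simp add: affine_vec_def)
    then have "v (a # w) = contact_lift (a # w) (chart (a # w) p) (v (a # w) ?n)"
      using low v0' by (auto simp del: chart.simps)
    then show "v \<in> {velocity c 0 |c. contact_germ (a # w) c \<and> c 0 = p}"
      using cg c by (auto simp: contact_germ_def simp del: chart.simps contact_lift.simps)
  }
  {
    assume "v \<in> {velocity c 0 |c. contact_germ (a # w) c \<and> c 0 = p}"
    then obtain c where c: "chart_germ (a # w) c" "c 0 = p" "v = velocity c 0"
      "v (a # w) = contact_lift (a # w) (chart (a # w) p) (v (a # w) ?n)"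
      by (auto simp: contact_germ_def simp del: chart.simps contact_lift.simps)
    have ev: "\<forall>\<^sub>F t in nhds 0. c t \<in> chart_dom (a # w)" using c by (simp add: chart_germ_def)
    define r where "r = v (a # w) ?n $ a"
    have low: "velocity (proj \<circ> c) 0 w i = r *s v0 w i" for i
    proof (cases "i = ?n")
      case True
      then show ?thesis
        unfolding velocity_proj(1)[OF ev] v0' by (simp add: contact_lift_above)
    next
      case False
      then have "velocity (proj \<circ> c) 0 w i = contact_lift (a # w) (chart (a # w) p) (v (a # w) ?n) i"
        unfolding velocity_proj(1)[OF ev] using c(3,4) by (metis fun_upd_other)
      with False show ?thesis by (simp add: r_def v0' del: chart.simps)
    qed
    have "(\<lambda>w i. r *s v0 w i) \<in> Delta (length w) z" by (rule Delta_scale[OF g pz(2) v0(1)])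
    then obtain c' where c': "chart_germ w c'" "c' 0 = z" "(\<lambda>w i. r *s v0 w i) = velocity c' 0"
      using Delta_E[OF g pz(2)] by metis
    have "velocity (proj \<circ> c) 0 = velocity c' 0"
    proof (rule velocity_eqI[OF _ chart_germ_proj[OF c(1)] c'(1)])
      show "all_compatible w" using g by (simp add: good_chart_def)
      show "(proj \<circ> c) 0 = c' 0" by (simp add: c c' pz)
      show "velocity (proj \<circ> c) 0 w = velocity c' 0 w" using low c'(3) by (metis ext)
    qed
    then have "velocity (proj \<circ> c) 0 = (\<lambda>w i. r *s v0 w i)" using c'(3) by simp
    then have "velocity (proj \<circ> c) 0 \<in> l" unfolding v0(2) tspan_def by blast
    moreover have "holo_germ (monster ?n) c"
      using c(1) by (auto simp: holo_germ_monster_iff intro!: exI[of _ "a # w"])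
    ultimately show "v \<in> Delta (length (a # w)) p"
      using c(2,3) by (auto simp: Delta_Suc dproj_preimage_def pz(1))
  }
qed

lemma good_chart_Nil: "good_chart ([] :: 'n::finite list)"
proof -
  have dom: "chart_dom [] = range Base"
    by (auto simp: chart_dom_def monster_0)
  have "chart_bij ([] :: 'n list)"
    unfolding chart_bij_def bij_betw_def
  proof (intro conjI inj_onI set_eqI iffI)
    fix p p' :: "'n mpoint"
    assume "p \<in> chart_dom []" "p' \<in> chart_dom []" "chart [] p = chart [] p'"
    then show "p = p'" by (auto simp: dom dest: fun_cong[of _ _ 0])
  next
    fix y :: "nat \<Rightarrow> complex ^ 'n" assume "y \<in> coord_space []"
    then have "y = chart [] (Base (y 0))" by auto
    then show "y \<in> chart [] ` chart_dom []" unfolding dom by blast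
  qed (auto simp: dom)
  moreover have "rational_transition [] [] (\<lambda>i (b::'n). if i = 0 then Coord i b else Const 0)"
    by (auto simp: rational_transition_def dom)
  then have "all_compatible ([] :: 'n list)"
    by (auto simp: all_compatible_def compatible_def chart_germ_def)
  moreover have "Delta_is_contact ([] :: 'n list)"
  proof -
    have holo: "holo_germ (range Base) c \<longleftrightarrow> chart_germ [] c" for c :: "complex \<Rightarrow> 'n mpoint"
      using holo_germ_monster_iff[of 0 c] by (simp add: monster_0)
    have "velocity c 0 [] = contact_lift [] y (velocity c 0 [] 0)" for c :: "complex \<Rightarrow> 'n mpoint" and y
      using velocity_above[of "[]" _ c 0] by auto
    then show ?thesis
      by (auto simp: Delta_is_contact_def Delta_0 tangent_def holo contact_germ_def simp del: contact_lift.simps)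
  qed
  ultimately show ?thesis by (simp add: good_chart_def)
qed

text \<open>
  Simultaneous induction over all words of a given length. Bijectivity and the contact equations on one
  level enter the construction of the transition maps on the next.
\<close>

lemma good_chart: "good_chart (w :: 'n::finite list)"
proof -
  have "\<forall>w :: 'n list. length w = k \<longrightarrow> good_chart w" for k
  proof (induction k)
    case 0
    then show ?case by (simp add: good_chart_Nil)
  next
    case (Suc k)
    show ?case
    proof (intro allI impI)
      fix w :: "'n list" assume len: "length w = Suc k"
      then obtain a w1 where w: "w = a # w1" "length w1 = k" by (cases w) auto
      have comp: "compatible w' w''" if "length w' = Suc k" "length w'' = Suc k"
        for w' w'' :: "'n list"
        using that Suc.IH by (metis compatible_Cons length_Suc_conv)
      have g1: "good_chart w1" using Suc.IH w(2) by blast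
      show "good_chart w"
        unfolding good_chart_def all_compatible_def w(1)
        using chart_bij_Cons[OF g1] Delta_is_contact_Cons[OF g1] comp w(2) by simp
    qed
  qed
  then show ?thesis by blast
qed

lemma chart_bij: "chart_bij w" and all_compatible: "all_compatible w"
  using good_chart[of w] by (simp_all add: good_chart_def)

section \<open>Two critical hyperplanes\<close>

text \<open>
  A germ that is holomorphic in some chart is holomorphic in every chart around its base point.
\<close>

lemma holo_germ_imp_chart_germ:
  assumes "holo_germ (monster k) c" "c 0 \<in> chart_dom w" "length w = k"
  shows "chart_germ w c"
proof -
  obtain w' where "length w' = k" "chart_germ w' c"
    using assms(1) by (auto simp: holo_germ_monster_iff)
  moreover have "compatible w' w"
    using all_compatible[of w'] assms(3) calculation(1) by (simp add: all_compatible_def)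
  ultimately show ?thesis using assms(2) chart_germ_change by blast
qed

lemma chart_germ_holo_germI:
  "chart_germ w c \<Longrightarrow> (\<And>t. c t \<in> S) \<Longrightarrow> holo_germ S c"
  unfolding holo_germ_def chart_germ_def chart_dom_def by (auto elim: eventually_mono)

text \<open>
  Every vector of the distribution is the velocity of a straight curve. The other critical objects are
  defined through velocities of curves in smaller sets; membership is proved by showing that this curve
  stays in the set.
\<close>

lemma straight_realises:
  assumes "z \<in> chart_dom w" "v \<in> Delta (length w) z"
  shows "v w \<in> coord_space w" and "velocity (straight_curve w z (v w)) 0 = v"
proof -
  obtain c where c: "chart_germ w c" "c 0 = z" "v = velocity c 0"
    "v w = contact_lift w (chart w z) (v w (length w))"
    using Delta_E[OF good_chart assms] by metis
  show e: "v w \<in> coord_space w" by (metis c(4) contact_lift_in_coord_space)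
  note s = straight_curve[OF chart_bij assms(1) e]
  have "velocity (straight_curve w z (v w)) 0 = velocity c 0"
    by (rule velocity_eqI[OF all_compatible s(4) c(1)]) (use s(3,5) c in simp_all)
  then show "velocity (straight_curve w z (v w)) 0 = v" by (simp add: c(3))
qed

text \<open>
  If the component at the letter of the chart vanishes, the contact equations make all lower components
  vanish, so that the straight curve stays in the fibre.
\<close>

lemma vertical_in_tangent_fibre:
  fixes a :: "'n::finite" and w :: "'n list"
  defines "n \<equiv> Suc (length w)"
  assumes z: "z \<in> chart_dom (a # w)" and v: "v \<in> Delta n z" and va: "v (a # w) n $ a = 0"
  shows "v \<in> tangent (fibre n z) z"
proof -
  have v': "v \<in> Delta (length (a # w)) z" using v by (simp add: n_def)
  let ?e = "v (a # w)"
  let ?c = "straight_curve (a # w) z ?e"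
  note e = straight_realises(1)[OF z v']
  note s = straight_curve[OF chart_bij z e]
  have ei: "?e i = 0" if "i \<noteq> n" for i
    using fun_cong[OF Delta_lift[OF good_chart z v'], of i] that va by (simp add: n_def)
  have pc: "proj (?c t) = proj z" for t
  proof (rule chart_eqD[OF chart_bij])
    show "proj (?c t) \<in> chart_dom w" "proj z \<in> chart_dom w"
      using chart_dom_proj s(2) z by blast+
    show "chart w (proj (?c t)) = chart w (proj z)"
      unfolding chart_proj_Cons[OF z] chart_proj_Cons[OF s(2)] s(1)
      by (rule ext) (simp add: ei n_def del: chart.simps)
  qed
  have "?c t \<in> fibre n z" for t
    using s(2)[of t] pc[of t] by (simp add: fibre_def chart_dom_def n_def)
  then have "holo_germ (fibre n z) ?c" by (rule chart_germ_holo_germI[OF s(4)])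
  then show ?thesis
    unfolding tangent_def mem_Collect_eq
    by (intro exI[of _ ?c]) (simp add: s(3) straight_realises(2)[OF z v'])
qed

lemma chart_dom_level: "z \<in> chart_dom w \<Longrightarrow> z \<in> monster (length w)"
  by (simp add: chart_dom_def)

lemma is_line_subset: "is_line D l \<Longrightarrow> v \<in> l \<Longrightarrow> v \<in> D"
  by (auto simp: is_line_def)

text \<open>
  The critical hyperplane avoided here is \<open>\<delta>\<^sub>n\<^sup>0 = V\<^sub>n\<close>, which in the chart \<open>a # w\<close> is given by the vanishing
  of the component at \<open>a\<close>.
\<close>

lemma regular_line_transverse_to_fibre:
  fixes a :: "'n::finite" and w :: "'n list"
  defines "n \<equiv> Suc (length w)"
  assumes z: "z \<in> chart_dom (a # w)" and l: "regular_line n z l" and v: "v \<in> l" "v \<noteq> tzero"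
  shows "v (a # w) n $ a \<noteq> 0"
proof
  assume va: "v (a # w) n $ a = 0"
  have line: "is_line (Delta n z) l" using l by (simp add: regular_line_def)
  have lv: "l = tspan v" by (rule line_eq_tspan[OF line v])
  have "v' \<in> tangent (fibre n z) z" if "v' \<in> l" for v'
  proof -
    have "v' (a # w) n $ a = 0" using that va unfolding lv by (auto simp: tspan_def)
    moreover have "v' \<in> Delta n z" using line that by (rule is_line_subset)
    ultimately show ?thesis
      using vertical_in_tangent_fibre[OF z] unfolding n_def by blast
  qed
  then have "l \<subseteq> snd (tower (fibre n ((proj ^^ 0) z)) 0) z" by auto
  moreover have "z \<in> fibre n z"
    using chart_dom_level[OF z] by (simp add: fibre_def n_def)
  then have "snd (tower (fibre n ((proj ^^ 0) z)) 0) z \<in> critical_hyperplanes n z"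
    unfolding critical_hyperplanes_def mem_Collect_eq
    by (intro exI[of _ n] exI[of _ "0::nat"] conjI) (simp_all add: n_def)
  ultimately show False using l by (auto simp: regular_line_def)
qed

text \<open>
  The component at \<open>a\<close> is a copy of one in the row below, and so vanishes together with the projected
  velocity.
\<close>

lemma vertical_line_coord:
  fixes a :: "'n::finite" and w :: "'n list"
  defines "n \<equiv> Suc (length w)"
  assumes z: "z \<in> chart_dom (a # w)" and l: "vertical_line n z l" and v: "v \<in> l"
  shows "v (a # w) n $ a = 0"
proof -
  obtain c where c: "v = velocity c 0" "holo_germ (monster n) c" "c 0 = z"
    "velocity (proj \<circ> c) 0 = tzero"
    using l v unfolding vertical_line_def vertical_space_def dproj_preimage_def by blast
  have "chart_germ (a # w) c"
    using holo_germ_imp_chart_germ[OF c(2)] c(3) z by (simp add: n_def)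
  then have ev: "\<forall>\<^sub>F t in nhds 0. c t \<in> chart_dom (a # w)" by (simp add: chart_germ_def)
  have "(velocity c 0 (a # w))(n := 0) = tzero w"
    using velocity_proj(1)[OF ev] c(4) by (simp add: n_def)
  then have "velocity c 0 (a # w) (length w) = 0"
    by (auto simp: tzero_def n_def dest: fun_cong[of _ _ "length w"])
  then show ?thesis using velocity_proj(2)[OF ev] by (simp add: c(1) n_def)
qed

text \<open>
  The definition of \<open>Delta\<close> only yields some curve with the given velocity whose projection has velocity
  on the line. Compatibility of charts transfers this to the given curve.
\<close>

lemma velocity_proj_in_line:
  assumes c: "chart_germ (a # w) c" "velocity c 0 \<in> Delta (Suc (length w)) (c 0)"
    and c0: "c 0 = Prol z l"
  shows "velocity (proj \<circ> c) 0 \<in> l"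
proof -
  obtain c' where c': "velocity c 0 = velocity c' 0" "holo_germ (monster (Suc (length w))) c'"
    "c' 0 = c 0" "velocity (proj \<circ> c') 0 \<in> l"
    using c(2) unfolding Delta_Suc dproj_preimage_def c0 line_of.simps by auto
  have g': "chart_germ (a # w) c'"
    using holo_germ_imp_chart_germ[OF c'(2)] chart_germ_dom[OF c(1)] c'(3) by simp
  have "velocity (proj \<circ> c) 0 = velocity (proj \<circ> c') 0"
  proof (rule velocity_eqI[OF all_compatible chart_germ_proj[OF c(1)] chart_germ_proj[OF g']])
    show "(proj \<circ> c) 0 = (proj \<circ> c') 0" by (simp add: c')
    show "velocity (proj \<circ> c) 0 w = velocity (proj \<circ> c') 0 w"
      using velocity_proj(1)[of c a w 0] velocity_proj(1)[of c' a w 0] c(1) g' c'(1)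
      unfolding chart_germ_def by metis
  qed
  then show ?thesis using c'(4) by simp
qed

text \<open>
  The critical hyperplane avoided here is \<open>\<delta>\<^sub>k\<^sup>1\<close>. The fibre through \<open>z\<close> is \<open>dx\<^sub>a = 0\<close> in the distribution,
  so its prolongation consists of the points at which the new coordinate \<open>dx\<^sub>a / dy\<^sub>k\<^sub>,\<^sub>b\<close> is zero, and is tangent
  to the vectors whose component at this coordinate vanishes. For such a vector the straight curve stays
  in the prolonged fibre.
\<close>

lemma regular_line_transverse_to_prolonged_fibre:
  fixes a b :: "'n::finite" and w :: "'n list"
  defines "k \<equiv> Suc (length w)"
  assumes p: "Prol z l \<in> chart_dom (b # a # w)" and ba: "b \<noteq> a"
    and l: "vertical_line k z l"
    and l': "regular_line (Suc k) (Prol z l) l'" and v: "v \<in> l'" "v \<noteq> tzero"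
  shows "v (b # a # w) (Suc k) $ a \<noteq> 0"
proof
  let ?w = "a # w" and ?W = "b # a # w" and ?p = "Prol z l"
  define F where "F = fibre k z"
  assume va: "v ?W (Suc k) $ a = 0"
  have lenw: "length ?w = k" and lenW: "length ?W = Suc k" by (simp_all add: k_def)
  have z: "z \<in> chart_dom ?w" "is_line (Delta k z) l"
    using p by (simp_all add: chart_dom_Cons lenw[symmetric])
  have line: "is_line (Delta (Suc k) ?p) l'" using l' by (simp add: regular_line_def)
  have lv: "l' = tspan v" by (rule line_eq_tspan[OF line v])
  have zF: "z \<in> F" using chart_dom_level[OF z(1)] by (simp add: F_def fibre_def k_def)
  have line_F: "is_line (tangent F z') m"
    if "z' \<in> chart_dom ?w" "proj z' = proj z" "is_line (Delta k z') m"
      "\<And>u. u \<in> m \<Longrightarrow> u ?w k $ a = 0" for z' m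
  proof -
    have "fibre k z' = F" using that(2) by (simp add: F_def fibre_def)
    then have "u \<in> tangent F z'" if "u \<in> m" for u
      using vertical_in_tangent_fibre[OF \<open>z' \<in> chart_dom ?w\<close>, folded k_def]
        is_line_subset[OF \<open>is_line (Delta k z') m\<close> that] \<open>\<And>u. u \<in> m \<Longrightarrow> u ?w k $ a = 0\<close>[OF that]
      by metis
    then show ?thesis using that(3) by (auto simp: is_line_def)
  qed
  have la: "u ?w k $ a = 0" if "u \<in> l" for u
    using vertical_line_coord[OF z(1), folded k_def] l that by blast
  have "is_line (tangent F z) l"
    by (rule line_F[OF z(1) _ z(2)]) (simp_all add: la)
  then have pPD: "?p \<in> PD F (tangent F)" using zF by (auto simp: PD_def)
  \<comment> \<open>the line \<open>l\<close> is vertical, so the affine coordinate \<open>a\<close> of its normalised generator vanishes\<close>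
  obtain g where g: "g \<in> Delta k z" "l = tspan g" "g ?w k = affine_vec b (chart ?W ?p (Suc k))"
    using line_generator[OF good_chart p] unfolding lenw by metis
  have ya: "chart ?W ?p (Suc k) $ a = 0"
    using la[of g] g tspan_self[of g] ba by (simp add: affine_vec_def del: chart.simps)
  have hyper: "u \<in> prol_dist F (tangent F) ?p" if u: "u \<in> l'" for u
  proof -
    have ua: "u ?W (Suc k) $ a = 0" using u va unfolding lv by (auto simp: tspan_def)
    have uD: "u \<in> Delta (length ?W) ?p" using is_line_subset[OF line u] by (simp add: lenW[symmetric])
    let ?e = "u ?W"
    let ?c = "straight_curve ?W ?p ?e"
    note s = straight_curve[OF chart_bij p straight_realises(1)[OF p uD]]
    have vel: "velocity ?c 0 = u" by (rule straight_realises(2)[OF p uD])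
    have e: "?e i = 0" if "i < k" for i
    proof -
      have "?e i = contact_lift ?W (chart ?W ?p) (?e (Suc k)) i"
        using Delta_lift[OF good_chart p uD] unfolding lenW by metis
      also have "\<dots> = 0"
        using that ya ba by (simp add: k_def affine_vec_def del: chart.simps)
      finally show ?thesis .
    qed
    \<comment> \<open>its points stay over the fibre, and their lines stay vertical\<close>
    have cPD: "?c t \<in> PD F (tangent F)" for t
    proof -
      obtain z' m where c: "?c t = Prol z' m" "z' \<in> chart_dom ?w" "is_line (Delta k z') m"
        using chart_dom_ConsE[OF s(2)[of t]] unfolding lenw by metis
      have pz: "proj z' = proj z"
      proof (rule chart_eqD[OF chart_bij])
        show "proj z' \<in> chart_dom w" "proj z \<in> chart_dom w"
          using c(2) z(1) chart_dom_proj by blast+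
        have "chart ?w z' i = chart ?w z i" if "i < k" for i
        proof -
          have "chart ?w z' i = chart ?W (?c t) i" using that c(1) lenw by simp
          also have "\<dots> = chart ?W ?p i" using that by (simp add: s(1) e del: chart.simps)
          also have "\<dots> = chart ?w z i" using that lenw by simp
          finally show ?thesis .
        qed
        then have "chart ?w z' i = chart ?w z i" if "i \<noteq> k" for i
          using that chart_above[of ?w i] lenw by (cases "i < k") (simp_all del: chart.simps)
        then show "chart w (proj z') = chart w (proj z)"
          unfolding chart_proj_Cons[OF c(2)] chart_proj_Cons[OF z(1)]
          by (auto simp: k_def simp del: chart.simps)
      qed
      obtain g' where g': "m = tspan g'" "g' ?w k = affine_vec b (chart ?W (?c t) (Suc k))"
        using line_generator[OF good_chart s(2)[of t, unfolded c(1)]] unfolding lenw c(1) by metis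
      have "g' ?w k $ a = 0"
        using ba ya ua by (simp add: g'(2) affine_vec_def s(1) del: chart.simps)
      then have "h ?w k $ a = 0" if "h \<in> m" for h
        using that by (auto simp: g'(1) tspan_def)
      then have "is_line (tangent F z') m" by (rule line_F[OF c(2) pz c(3)])
      moreover have "z' \<in> F"
        using chart_dom_level[OF c(2)] pz by (simp add: F_def fibre_def k_def)
      ultimately show ?thesis by (auto simp: PD_def c(1))
    qed
    have "holo_germ (PD F (tangent F)) ?c" by (rule chart_germ_holo_germI[OF s(4) cPD])
    moreover have "velocity (proj \<circ> ?c) 0 \<in> l"
      by (rule velocity_proj_in_line[OF s(4)])
        (use vel uD s(3) in \<open>simp_all del: chart.simps\<close>)
    ultimately show ?thesis
      unfolding prol_dist_def dproj_preimage_def line_of.simps mem_Collect_eq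
      by (intro exI[of _ ?c]) (simp only: vel s(3) simp_thms)
  qed
  let ?H = "snd (tower (fibre k ((proj ^^ 1) ?p)) 1) ?p"
  have "?H \<in> critical_hyperplanes (Suc k) ?p"
    unfolding critical_hyperplanes_def mem_Collect_eq using pPD
    by (intro exI[of _ k] exI[of _ "1::nat"] conjI) (simp_all add: k_def F_def)
  moreover have "l' \<subseteq> ?H" using hyper by (auto simp: F_def)
  ultimately show False using l' by (auto simp: regular_line_def)
qed

section \<open>Projecting regular germs\<close>

lemma eventually_analytic:
  assumes "f analytic_on {a}"
  shows "\<forall>\<^sub>F t in nhds a. f analytic_on {t}"
proof -
  obtain S where "open S" "a \<in> S" "f analytic_on S"
    using assms by (metis analytic_at analytic_on_open)
  then show ?thesis
    unfolding eventually_nhds by (metis analytic_on_analytic_at)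
qed

text \<open>
  Velocities at nonzero times are velocities at time 0 of shifted germs; only the latter occur in the
  definition of the distributions.
\<close>

lemma chart_germ_shift:
  assumes "chart_germ w c"
  shows "\<forall>\<^sub>F t in nhds 0. chart_germ w (\<lambda>s. c (t + s))"
proof -
  have an: "\<And>i b. (\<lambda>t. chart w (c t) i $ b) analytic_on {0}"
    and ev: "\<forall>\<^sub>F t in nhds 0. c t \<in> chart_dom w"
    using assms by (auto simp: chart_germ_def)
  have "\<forall>\<^sub>F t in nhds 0. (\<lambda>t. chart w (c t) i $ b) analytic_on {t}" for i b
    by (rule eventually_analytic[OF an])
  then have "\<forall>\<^sub>F t in nhds 0. \<forall>i\<in>{..length w}. \<forall>b\<in>UNIV. (\<lambda>t. chart w (c t) i $ b) analytic_on {t}"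
    by (intro eventually_ball_finite ballI) auto
  moreover have "\<forall>\<^sub>F t in nhds 0. \<forall>\<^sub>F s in nhds t. c s \<in> chart_dom w"
    using ev by (simp add: eventually_eventually)
  ultimately show ?thesis
  proof eventually_elim
    case (elim t)
    have lim: "((\<lambda>s. t + s) \<longlongrightarrow> t) (nhds 0)"
      using tendsto_add[OF tendsto_const filterlim_ident[of "nhds (0::complex)"], of t] by simp
    have "\<forall>\<^sub>F s in nhds 0. c (t + s) \<in> chart_dom w"
      using eventually_compose_filterlim[OF elim(2) lim] .
    moreover have "(\<lambda>s. chart w (c (t + s)) i $ b) analytic_on {0}" for i b
    proof (cases "i \<le> length w")
      case True
      have shift: "(\<lambda>s. t + s) analytic_on {0}" by (intro analytic_intros)
      show ?thesis
        using analytic_on_compose_gen[OF shift, of "\<lambda>s. chart w (c s) i $ b" "{t}"] elim(1) True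
        by (simp add: o_def)
    next
      case False
      then show ?thesis by (simp add: chart_above)
    qed
    ultimately show ?case by (simp add: chart_germ_def)
  qed
qed

lemma velocity_shift: "velocity (\<lambda>s. c (t + s)) 0 = velocity c t"
  unfolding velocity_def
  by (intro ext) (simp add: deriv_shift_0[of _ t] o_def)

lemma integral_germ_proj:
  assumes "integral_germ (monster (Suc k)) (Delta (Suc k)) c"
  shows "integral_germ (monster k) (Delta k) (proj \<circ> c)"
proof -
  obtain w' where w': "length w' = Suc k" "chart_germ w' c"
    using assms by (auto simp: integral_germ_def holo_germ_monster_iff)
  then obtain a w where w: "w' = a # w" "length w = k" by (cases w') auto
  have cg: "chart_germ (a # w) c" using w' w by simp
  have "\<forall>\<^sub>F t in nhds 0. velocity c t \<in> Delta (Suc k) (c t)"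
    using assms by (simp add: integral_germ_def)
  with chart_germ_shift[OF cg] have "\<forall>\<^sub>F t in nhds 0. velocity (proj \<circ> c) t \<in> Delta k ((proj \<circ> c) t)"
  proof eventually_elim
    case (elim t)
    have dom: "c t \<in> chart_dom (a # w)" using chart_germ_dom[OF elim(1)] by simp
    then obtain z l where z: "c t = Prol z l" "is_line (Delta (length w) z) l"
      by (rule chart_dom_ConsE)
    have "velocity (proj \<circ> (\<lambda>s. c (t + s))) 0 \<in> l"
      by (rule velocity_proj_in_line[OF elim(1)]) (use elim(2) w z in \<open>simp_all add: velocity_shift\<close>)
    then have "velocity (proj \<circ> c) t \<in> l"
      using velocity_shift[of "proj \<circ> c" t] by (simp add: o_def)
    then show ?case using z w by (auto simp: is_line_def)
  qed
  then show ?thesis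
    using chart_germ_proj[OF cg] w(2) by (auto simp: integral_germ_def holo_germ_monster_iff)
qed

text \<open>
  A regular line is not vertical, so its projection is again a line, and it is the line recorded in the point
  by \<open>velocity_proj_in_line\<close>.
\<close>

lemma regular_germ_proj:
  assumes c: "regular_germ (Suc k) c" and c0: "c 0 = Prol z l" and l: "regular_line k z l"
  shows "regular_germ k (proj \<circ> c)"
proof -
  have int: "integral_germ (monster (Suc k)) (Delta (Suc k)) c" and nz: "velocity c 0 \<noteq> tzero"
    and reg: "regular_line (Suc k) (c 0) (tspan (velocity c 0))"
    using c by (auto simp: regular_germ_def)
  obtain w' where w': "length w' = Suc k" "chart_germ w' c"
    using int by (auto simp: integral_germ_def holo_germ_monster_iff)
  then obtain a w where w: "w' = a # w" "length w = k" by (cases w') auto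
  have cg: "chart_germ (a # w) c" using w' w by simp
  have ev: "\<forall>\<^sub>F t in nhds 0. c t \<in> chart_dom (a # w)" using cg by (simp add: chart_germ_def)
  have "velocity c 0 (a # w) (Suc k) $ a \<noteq> 0"
    using regular_line_transverse_to_fibre[OF chart_germ_dom[OF cg] _ tspan_self nz] reg w(2) by simp
  then have "velocity (proj \<circ> c) 0 w k $ a \<noteq> 0"
    using velocity_proj[OF ev] w(2) by simp
  then have nz': "velocity (proj \<circ> c) 0 \<noteq> tzero" by (auto simp: tzero_def)
  have "velocity c 0 \<in> Delta (Suc k) (c 0)"
    using int by (auto simp: integral_germ_def dest: eventually_nhds_x_imp_x)
  then have "velocity (proj \<circ> c) 0 \<in> l"
    using velocity_proj_in_line[OF cg _ c0] w(2) by simp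
  moreover have "is_line (Delta k z) l" using l by (simp add: regular_line_def)
  ultimately have "l = tspan (velocity (proj \<circ> c) 0)" using nz' line_eq_tspan by blast
  then show ?thesis
    using integral_germ_proj[OF int] nz' l c0 by (simp add: regular_germ_def)
qed

lemma regular_germ_descend:
  fixes c :: "complex \<Rightarrow> 'n::finite mpoint"
  assumes "regular_germ (k + q) c" "rvt_code (c 0) = u @ replicate q R" "length u = k"
  shows "regular_germ k ((proj ^^ q) \<circ> c) \<and> rvt_code (((proj ^^ q) \<circ> c) 0) = u"
  using assms
proof (induction q arbitrary: c)
  case (Suc q)
  have mon: "c 0 \<in> monster (Suc (k + q))"
    using Suc.prems(1)
    by (auto simp: regular_germ_def integral_germ_def holo_germ_def dest: eventually_nhds_x_imp_x)
  then obtain z l where z: "c 0 = Prol z l" "z \<in> monster (k + q)" by (rule monster_SucE)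
  have code: "rvt_code z = u @ replicate q R" and "regular_line (level z) z l"
    using Suc.prems(2) unfolding z(1)
    by (auto simp: replicate_append_same[symmetric] simp flip: append_assoc split: if_splits)
  then have "regular_germ (k + q) (proj \<circ> c)"
    using regular_germ_proj[of "k + q" c z l] Suc.prems(1) z monster_level[OF z(2)] by simp
  from Suc.IH[OF this] code Suc.prems(3) z(1) show ?case
    by (simp add: funpow_Suc_right o_assoc del: funpow.simps)
qed auto

section \<open>The curve below an iterated prolongation\<close>

primrec base_point :: "'n::finite mpoint \<Rightarrow> complex ^ 'n" where
  "base_point (Base x) = x"
| "base_point (Prol z l) = base_point z"

lemma base_point_proj_pow: "base_point ((proj ^^ q) z) = base_point z"
proof (induction q)
  case (Suc q)
  have "base_point (proj y) = base_point y" for y :: "'a mpoint" by (cases y) auto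
  with Suc show ?case by simp
qed simp

lemma chart_base_point: "in_chart w z \<Longrightarrow> chart w z 0 = base_point z"
  by (induction w z rule: in_chart.induct) auto

lemma eventually_punctured_nhds:
  fixes a :: "'a::t1_space"
  assumes "\<forall>\<^sub>F t in at a. P t"
  shows "\<forall>\<^sub>F t in at a. \<forall>\<^sub>F s in nhds t. P s"
proof -
  obtain S where S: "open S" "a \<in> S" "\<And>x. x \<in> S \<Longrightarrow> x \<noteq> a \<Longrightarrow> P x"
    using assms by (auto simp: eventually_at_topological)
  have "\<forall>\<^sub>F s in nhds t. P s" if "t \<in> S" "t \<noteq> a" for t
    unfolding eventually_nhds using S that by (intro exI[of _ "S - {a}"]) auto
  then show ?thesis using S(1,2) by (auto simp: eventually_at_topological)
qed

text \<open>
  For a nonconstant germ this makes the derivative nonzero at all small nonzero times, where a prolongation is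
  determined by the curve below it.
\<close>

lemma deriv_isolated_zero:
  assumes "f analytic_on {0}" and "\<not> (\<forall>\<^sub>F t in nhds 0. f t = f 0)"
  shows "\<forall>\<^sub>F t in at (0::complex). deriv f t \<noteq> 0"
proof -
  obtain r where r: "r > 0" "f holomorphic_on ball 0 r"
    using assms(1) by (auto simp: analytic_on_def)
  have d: "deriv f holomorphic_on ball 0 r" using r by (intro holomorphic_deriv) auto
  have "\<exists>\<beta>\<in>ball 0 r. deriv f \<beta> \<noteq> 0"
  proof (rule ccontr)
    assume *: "\<not> ?thesis"
    have "(f has_field_derivative 0) (at t within ball 0 r)" if "t \<in> ball 0 r" for t
      using * that r(2) holomorphic_derivI[OF r(2) open_ball that]
      by (auto intro: has_field_derivative_at_within)
    then obtain k where "\<And>t. t \<in> ball 0 r \<Longrightarrow> f t = k"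
      using has_field_derivative_zero_constant[OF convex_ball] by blast
    note k = this
    have "\<forall>\<^sub>F t in nhds 0. t \<in> ball 0 r" using r(1) by (intro eventually_nhds_in_open) auto
    then have "\<forall>\<^sub>F t in nhds 0. f t = f 0"
      by eventually_elim (use r(1) in \<open>simp add: k del: mem_ball\<close>)
    then show False using assms(2) by simp
  qed
  then obtain \<beta> where \<beta>: "\<beta> \<in> ball 0 r" "deriv f \<beta> \<noteq> 0" by blast
  show ?thesis
  proof (cases "deriv f 0 = 0")
    case True
    show ?thesis
    proof (rule isolated_zeros[OF d open_ball connected_ball _ True \<beta>])
      show "0 \<in> ball 0 r" using r(1) by simp
      fix r' assume "0 < r'" "\<And>z. z \<in> ball 0 r' - {0} \<Longrightarrow> deriv f z \<noteq> 0"
      then show ?thesis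
        unfolding eventually_at_topological
        by (intro exI[of _ "ball 0 r'"] conjI ballI impI open_ball)
          (simp_all del: mem_ball add: centre_in_ball)
    qed
  next
    case False
    have "isCont (deriv f) 0"
      by (intro analytic_at_imp_isCont analytic_deriv assms(1))
    then show ?thesis using False unfolding isCont_def by (rule tendsto_imp_eventually_ne)
  qed
qed

text \<open>
  The hypothesis on one component of \<open>\<gamma>\<close> keeps the velocities of all prolongations nonzero away from 0,
  because row 0 of every chart is the point of \<open>\<complex>\<^sup>n\<close> below.
\<close>

lemma nth_prolongation_base_point:
  fixes \<gamma> :: "complex \<Rightarrow> complex ^ 'n::finite"
  assumes g: "\<forall>\<^sub>F t in at 0. deriv (\<lambda>s. \<gamma> s $ b) t \<noteq> 0"
    and "nth_prolongation j \<gamma> \<sigma>"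
  shows "\<forall>\<^sub>F t in at 0. base_point (\<sigma> t) = \<gamma> t"
  using assms(2)
proof (induction j arbitrary: \<sigma>)
  case (Suc j)
  then obtain \<rho> where \<rho>: "nth_prolongation j \<gamma> \<rho>" "prolongs (monster j) (Delta j) \<rho> \<sigma>" by auto
  have IH: "\<forall>\<^sub>F t in at 0. base_point (\<rho> t) = \<gamma> t" by (rule Suc.IH[OF \<rho>(1)])
  obtain w where w: "chart_germ w \<rho>"
    using \<rho>(2) by (auto simp: prolongs_def integral_germ_def holo_germ_monster_iff)
  have "\<forall>\<^sub>F t in at 0. \<rho> t \<in> chart_dom w"
    using w by (auto simp: chart_germ_def eventually_nhds_conv_at)
  with IH have "\<forall>\<^sub>F t in at 0. \<rho> t \<in> chart_dom w \<and> base_point (\<rho> t) = \<gamma> t" by eventually_elim simp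
  from eventually_punctured_nhds[OF this] g
  have vel: "\<forall>\<^sub>F t in at 0. velocity \<rho> t \<noteq> tzero"
  proof eventually_elim
    case (elim t)
    have "deriv (\<lambda>s. chart w (\<rho> s) 0 $ b) t = deriv (\<lambda>s. \<gamma> s $ b) t"
      by (rule deriv_cong_ev)
        (use elim(1) in \<open>auto elim!: eventually_mono simp: chart_base_point chart_dom_def\<close>)
    moreover have "in_chart w (\<rho> t)"
      using eventually_nhds_x_imp_x[OF elim(1)] by (simp add: chart_dom_def)
    ultimately have "velocity \<rho> t w 0 $ b \<noteq> 0" using elim(2) by (simp add: velocity_def)
    then show ?case by (auto simp: tzero_def)
  qed
  have "\<forall>\<^sub>F t in at 0. velocity \<rho> t \<noteq> tzero \<longrightarrow> \<sigma> t = Prol (\<rho> t) (tspan (velocity \<rho> t))"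
    using \<rho>(2) by (auto simp: prolongs_def eventually_nhds_conv_at)
  with vel IH show ?case by eventually_elim simp
qed simp

text \<open>
  From level 1 on, \<open>\<gamma>\<close> is itself prolonged, and hence analytic and not constant. So it is the curve below its
  last prolongation, first away from 0 and then at 0 by continuity.
\<close>

lemma Germ_lift:
  assumes "\<gamma> \<in> Germ p" "level p \<ge> 1"
  obtains \<sigma> where "regular_germ (level p) \<sigma>" "\<sigma> 0 = p" "\<forall>\<^sub>F t in nhds 0. base_point (\<sigma> t) = \<gamma> t"
proof -
  obtain \<sigma> where \<sigma>: "nth_prolongation (level p) \<gamma> \<sigma>" "\<sigma> 0 = p" "regular_germ (level p) \<sigma>"
    using assms(1) by (auto simp: Germ_def)
  have first: "\<exists>\<rho>. prolongs (monster 0) (Delta 0) (Base \<circ> \<gamma>) \<rho>"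
    if "nth_prolongation (Suc j) \<gamma> \<tau>" for j \<tau>
    using that by (induction j arbitrary: \<tau>) auto
  obtain j where "level p = Suc j" using assms(2) by (cases "level p") auto
  then obtain \<rho> where \<rho>: "prolongs (monster 0) (Delta 0) (Base \<circ> \<gamma>) \<rho>"
    using first \<sigma>(1) by metis
  have "chart_germ [] (Base \<circ> \<gamma>)"
    using \<rho> by (auto simp: prolongs_def integral_germ_def holo_germ_monster_iff)
  then have an: "(\<lambda>t. \<gamma> t $ b) analytic_on {0}" for b
    by (auto simp: chart_germ_def dest: spec[of _ 0])
  have "\<exists>b. \<not> (\<forall>\<^sub>F t in nhds 0. \<gamma> t $ b = \<gamma> 0 $ b)"
  proof (rule ccontr)
    assume "\<not> ?thesis"
    then have "\<forall>\<^sub>F t in nhds 0. \<forall>b\<in>UNIV. \<gamma> t $ b = \<gamma> 0 $ b"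
      by (intro eventually_ball_finite) auto
    then have "\<forall>\<^sub>F t in nhds 0. (Base \<circ> \<gamma>) t = (Base \<circ> \<gamma>) 0"
      by eventually_elim (simp add: vec_eq_iff)
    with \<rho> show False by (simp add: prolongs_def)
  qed
  then obtain b where "\<not> (\<forall>\<^sub>F t in nhds 0. \<gamma> t $ b = \<gamma> 0 $ b)" by blast
  then have "\<forall>\<^sub>F t in at 0. deriv (\<lambda>s. \<gamma> s $ b) t \<noteq> 0"
    using deriv_isolated_zero[OF an] by blast
  from nth_prolongation_base_point[OF this \<sigma>(1)]
  have at0: "\<forall>\<^sub>F t in at 0. base_point (\<sigma> t) = \<gamma> t" .
  obtain w where w: "chart_germ w \<sigma>"
    using \<sigma>(3) by (auto simp: regular_germ_def integral_germ_def holo_germ_monster_iff)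
  have "base_point (\<sigma> 0) $ b = \<gamma> 0 $ b" for b
  proof (rule tendsto_unique[of "at (0::complex)"])
    show "((\<lambda>t. \<gamma> t $ b) \<longlongrightarrow> \<gamma> 0 $ b) (at 0)"
      using an analytic_at_imp_isCont isCont_def by blast
    have ev: "\<forall>\<^sub>F t in nhds 0. \<sigma> t \<in> chart_dom w" using w by (simp add: chart_germ_def)
    have "isCont (\<lambda>t. chart w (\<sigma> t) 0 $ b) 0"
      using w by (intro analytic_at_imp_isCont) (simp add: chart_germ_def)
    then have "((\<lambda>t. chart w (\<sigma> t) 0 $ b) \<longlongrightarrow> base_point (\<sigma> 0) $ b) (at 0)"
      using chart_germ_dom[OF w] by (simp add: isCont_def chart_dom_def chart_base_point)
    moreover have "\<forall>\<^sub>F t in at 0. chart w (\<sigma> t) 0 $ b = \<gamma> t $ b"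
      using at0 ev unfolding eventually_nhds_conv_at
      by (auto elim: eventually_elim2 simp: chart_base_point chart_dom_def)
    ultimately show "((\<lambda>t. \<gamma> t $ b) \<longlongrightarrow> base_point (\<sigma> 0) $ b) (at 0)"
      by (rule Lim_transform_eventually)
  qed simp
  then have "base_point (\<sigma> 0) = \<gamma> 0" by (simp add: vec_eq_iff)
  with at0 \<sigma>(2,3) that[of \<sigma>] show ?thesis by (simp add: eventually_nhds_conv_at)
qed

section \<open>Odd parts of iterated primitives\<close>

text \<open>
  Here \<open>f - f 0\<close> is the square of a function \<open>g\<close> with a simple zero, and \<open>\<tau>\<close> is the local inverse of \<open>g\<close>.
\<close>

lemma quadratic_parameter:
  assumes f: "f analytic_on {0}" and f1: "deriv f 0 = 0" and f2: "deriv (deriv f) 0 \<noteq> 0"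
  obtains \<tau> where "\<tau> analytic_on {0}" "\<tau> 0 = 0" "deriv \<tau> 0 \<noteq> 0"
    "\<forall>\<^sub>F s in nhds 0. f (\<tau> s) = f 0 + s ^ 2"
proof -
  obtain S where S: "open S" "0 \<in> S" "f holomorphic_on S"
    using f by (auto simp: analytic_at)
  obtain h r where r: "0 < r" and h: "h holomorphic_on ball 0 r"
    "\<And>w. w \<in> ball 0 r \<Longrightarrow> f w - f 0 = ((w - 0) * h w) ^ 2" "\<And>w. w \<in> ball 0 r \<Longrightarrow> h w \<noteq> 0"
  proof (rule holomorphic_factor_order_of_zero_strong[OF S(3,1,2), of 2])
    show "(deriv ^^ 2) f 0 \<noteq> 0" using f2 by (simp add: numeral_2_eq_2)
    show "(deriv ^^ i) f 0 = 0" if "0 < i" "i < 2" for i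
      using that f1 by (simp add: less_2_cases_iff)
  qed auto
  define g where "g w = w * h w" for w
  have g: "g holomorphic_on ball 0 r" unfolding g_def by (intro holomorphic_intros h)
  have zr: "0 \<in> ball 0 r" using r by simp
  have "(h has_field_derivative deriv h 0) (at 0)"
    by (rule holomorphic_derivI[OF h(1) open_ball zr])
  then have "(g has_field_derivative h 0) (at 0)"
    unfolding g_def by (auto intro!: derivative_eq_intros)
  then have dg: "deriv g 0 \<noteq> 0" using h(3)[OF zr] by (simp add: DERIV_imp_deriv)
  obtain r' where r': "0 < r'" "ball (0::complex) r' \<subseteq> ball 0 r" "open (g ` ball 0 r')" "inj_on g (ball 0 r')"
    using has_complex_derivative_locally_invertible[OF g zr open_ball dg] by metis
  obtain \<tau> where \<tau>: "\<tau> holomorphic_on (g ` ball 0 r')"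
    "\<And>z. z \<in> ball 0 r' \<Longrightarrow> deriv g z * deriv \<tau> (g z) = 1"
    "\<And>z. z \<in> ball 0 r' \<Longrightarrow> \<tau> (g z) = z"
    using holomorphic_has_inverse[OF holomorphic_on_subset[OF g r'(2)] open_ball r'(4)] by metis
  have z': "0 \<in> ball 0 r'" and g0: "g 0 = 0" using r'(1) by (simp_all add: g_def)
  have im: "0 \<in> g ` ball 0 r'" using z' g0 by (metis imageI)
  show ?thesis
  proof (rule that)
    show "\<tau> analytic_on {0}" using \<tau>(1) r'(3) im by (auto simp: analytic_at)
    show "\<tau> 0 = 0" using \<tau>(3)[OF z'] g0 by simp
    show "deriv \<tau> 0 \<noteq> 0" using \<tau>(2)[OF z'] g0 by auto
    have "\<forall>\<^sub>F s in nhds 0. s \<in> g ` ball 0 r'" using r'(3) im by (rule eventually_nhds_in_open)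
    then show "\<forall>\<^sub>F s in nhds 0. f (\<tau> s) = f 0 + s ^ 2"
    proof eventually_elim
      case (elim s)
      then obtain z where z: "z \<in> ball 0 r'" "s = g z" by blast
      then have "f z - f 0 = (g z) ^ 2" using h(2)[of z] r'(2) by (auto simp: g_def)
      then show ?case using \<tau>(3)[OF z(1)] z(2) by (simp add: algebra_simps)
    qed
  qed
qed

text \<open>
  Comparison of coefficients in \<open>F' = 2 s G\<close>: the coefficient of \<open>G\<close> at \<open>n\<close> moves to \<open>n + 2\<close>, up to a nonzero
  factor.
\<close>

lemma coefficients_of_primitive:
  fixes F G :: "complex \<Rightarrow> complex"
  assumes F: "F has_fps_expansion A" and G: "G has_fps_expansion B"
    and ode: "\<forall>\<^sub>F s in nhds 0. deriv F s = 2 * s * G s"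
  shows "of_nat (Suc (Suc n)) * fps_nth A (Suc (Suc n)) = 2 * fps_nth B n" and "fps_nth A 1 = 0"
proof -
  have "deriv F has_fps_expansion fps_deriv A" by (rule has_fps_expansion_deriv[OF F])
  moreover have "(\<lambda>s. 2 * s * G s) has_fps_expansion fps_const 2 * fps_X * B"
    by (intro has_fps_expansion_mult has_fps_expansion_const has_fps_expansion_fps_X G)
  then have "deriv F has_fps_expansion fps_const 2 * fps_X * B"
    using has_fps_expansion_cong[OF ode refl] by simp
  ultimately have eq: "fps_deriv A = fps_const 2 * (fps_X * B)"
    unfolding mult.assoc by (rule fps_expansion_unique_complex)
  show "of_nat (Suc (Suc n)) * fps_nth A (Suc (Suc n)) = 2 * fps_nth B n"
    using arg_cong[OF eq, of "\<lambda>H. fps_nth H (Suc n)"] by simp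
  show "fps_nth A 1 = 0"
    using arg_cong[OF eq, of "\<lambda>H. fps_nth H 0"] by simp
qed

lemma subsequence_fps_analytic:
  fixes A :: "complex fps"
  assumes A: "fps_conv_radius A > 0"
  shows "fps_conv_radius (Abs_fps (\<lambda>n. fps_nth A (m + 2 * n))) > 0"
proof -
  obtain r :: real where r: "0 < ereal r" "ereal r < fps_conv_radius A"
    using ereal_dense2[OF A] by blast
  let ?z = "of_real r :: complex"
  have "summable (\<lambda>n. norm (fps_nth A n * ?z ^ n))"
    using r by (intro abs_summable_in_conv_radius) (auto simp: fps_conv_radius_def)
  then have "summable ((\<lambda>n. norm (fps_nth A n * ?z ^ n)) \<circ> (\<lambda>n. m + 2 * n))"
    by (rule summable_reindex) (auto intro: inj_onI)
  then have "summable (\<lambda>n. fps_nth A (m + 2 * n) * ?z ^ (m + 2 * n))"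
    by (intro summable_norm_cancel[of "\<lambda>n. fps_nth A (m + 2 * n) * ?z ^ (m + 2 * n)"]) (simp add: o_def)
  then have "summable (\<lambda>n. inverse (?z ^ m) * (fps_nth A (m + 2 * n) * ?z ^ (m + 2 * n)))"
    by (rule summable_mult)
  also have "(\<lambda>n. inverse (?z ^ m) * (fps_nth A (m + 2 * n) * ?z ^ (m + 2 * n)))
      = (\<lambda>n. fps_nth A (m + 2 * n) * (?z ^ 2) ^ n)"
  proof
    fix n
    have "?z ^ (m + 2 * n) = ?z ^ m * (?z ^ 2) ^ n" by (simp only: power_add power_mult)
    then show "inverse (?z ^ m) * (fps_nth A (m + 2 * n) * ?z ^ (m + 2 * n))
        = fps_nth A (m + 2 * n) * (?z ^ 2) ^ n"
      using r(1) by simp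
  qed
  finally have "conv_radius (\<lambda>n. fps_nth A (m + 2 * n)) \<ge> norm (?z ^ 2)"
    by (rule conv_radius_geI)
  moreover have "norm (?z ^ 2) > 0" using r(1) by simp
  ultimately show ?thesis unfolding fps_conv_radius_def
    by (simp add: less_le_trans[of 0 "ereal (norm (?z ^ 2))"])
qed

lemma fps_compose_X_square_nth:
  "fps_nth (fps_compose B (fps_X ^ 2)) n = (if even n then fps_nth (B :: complex fps) (n div 2) else 0)"
proof -
  have "fps_nth (fps_compose B (fps_X ^ 2)) n = (\<Sum>i=0..n. fps_nth B i * (if n = 2 * i then 1 else 0))"
    unfolding fps_compose_nth power_mult[symmetric] fps_X_power_nth by simp
  also have "\<dots> = (\<Sum>i\<in>{0..n}. if i = n div 2 then (if even n then fps_nth B i else 0) else 0)"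
    by (rule sum.cong) auto
  also have "\<dots> = (if even n then fps_nth B (n div 2) else 0)" by (simp add: sum.delta)
  finally show ?thesis .
qed

text \<open>
  \<open>E\<close> and \<open>G\<close> collect the coefficients with even index, and those with odd index from \<open>2 k + 1\<close> on.
\<close>

lemma even_odd_decomposition:
  assumes F: "F has_fps_expansion A"
    and odd: "\<And>j. j < k \<Longrightarrow> fps_nth A (2 * j + 1) = 0"
  obtains E G where "E analytic_on {0}" "G analytic_on {0}" "G 0 = fps_nth A (2 * k + 1)"
    "\<forall>\<^sub>F s in nhds 0. F s = E (s ^ 2) + s ^ (2 * k + 1) * G (s ^ 2)"
proof -
  define B where "B = Abs_fps (\<lambda>n. fps_nth A (0 + 2 * n))"
  define C where "C = Abs_fps (\<lambda>n. fps_nth A (2 * k + 1 + 2 * n))"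
  have pos: "fps_conv_radius A > 0" using F by (simp add: has_fps_expansion_def)
  have B: "eval_fps B has_fps_expansion B" and C: "eval_fps C has_fps_expansion C"
    using subsequence_fps_analytic[OF pos, of 0] subsequence_fps_analytic[OF pos, of "2 * k + 1"]
    unfolding B_def C_def has_fps_expansion_def by auto
  have X: "(\<lambda>s::complex. s ^ 2) has_fps_expansion fps_X ^ 2" by (rule has_fps_expansion_fps_X_power)
  have X0: "fps_nth (fps_X ^ 2 :: complex fps) 0 = 0" by (simp add: fps_X_power_iff)
  have "A = fps_compose B (fps_X ^ 2) + fps_X ^ (2 * k + 1) * fps_compose C (fps_X ^ 2)"
  proof (rule fps_ext)
    fix n
    show "fps_nth A n = fps_nth (fps_compose B (fps_X ^ 2) + fps_X ^ (2 * k + 1) * fps_compose C (fps_X ^ 2)) n"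
    proof (cases "even n")
      case True
      then show ?thesis
        by (auto simp: fps_compose_X_square_nth fps_X_power_mult_nth B_def simp del: power_Suc)
    next
      case False
      then obtain j where j: "n = 2 * j + 1" by (elim oddE)
      show ?thesis
      proof (cases "j < k")
        case True
        then show ?thesis
          using odd[OF True] j by (simp add: fps_compose_X_square_nth fps_X_power_mult_nth del: power_Suc)
      next
        case False
        then have "n - (2 * k + 1) = 2 * (j - k)" "2 * k + 1 + 2 * (j - k) = n" using j by auto
        then show ?thesis
          using False j by (simp add: fps_compose_X_square_nth fps_X_power_mult_nth C_def del: power_Suc)
      qed
    qed
  qed
  moreover have "(\<lambda>s. (eval_fps B \<circ> (\<lambda>s. s ^ 2)) s + s ^ (2 * k + 1) * (eval_fps C \<circ> (\<lambda>s. s ^ 2)) s)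
      has_fps_expansion fps_compose B (fps_X ^ 2) + fps_X ^ (2 * k + 1) * fps_compose C (fps_X ^ 2)"
    by (intro has_fps_expansion_add has_fps_expansion_mult has_fps_expansion_fps_X_power
        has_fps_expansion_compose B C X X0)
  ultimately have G: "(\<lambda>s. eval_fps B (s ^ 2) + s ^ (2 * k + 1) * eval_fps C (s ^ 2)) has_fps_expansion A"
    by (simp add: o_def)
  have "\<forall>\<^sub>F s in nhds 0. F s = eval_fps B (s ^ 2) + s ^ (2 * k + 1) * eval_fps C (s ^ 2)"
    using F G unfolding has_fps_expansion_def by (auto elim: eventually_elim2)
  moreover have "eval_fps C 0 = fps_nth A (2 * k + 1)" by (simp add: eval_fps_at_0 C_def)
  ultimately show ?thesis
    using that[OF has_fps_expansion_imp_analytic_0[OF B] has_fps_expansion_imp_analytic_0[OF C]] by blast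
qed

text \<open>
  Each of the \<open>k\<close> integrations raises the order of the odd part by two. Before the first one this order is
  1 exactly if \<open>F k\<close> has a nonzero linear term.
\<close>

lemma iterated_primitives:
  fixes F :: "nat \<Rightarrow> complex \<Rightarrow> complex"
  assumes "\<And>i. i \<le> k \<Longrightarrow> F i analytic_on {0}"
    and "\<And>i. i < k \<Longrightarrow> \<forall>\<^sub>F s in nhds 0. deriv (F i) s = 2 * s * F (Suc i) s"
  shows "(\<forall>j<k. fps_nth (fps_expansion (F 0) 0) (2 * j + 1) = 0) \<and>
    (deriv (F k) 0 \<noteq> 0 \<longrightarrow> fps_nth (fps_expansion (F 0) 0) (2 * k + 1) \<noteq> 0)"
  using assms
proof (induction k arbitrary: F)
  case 0
  then show ?case by (simp add: fps_expansion_def)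
next
  case (Suc k)
  let ?A = "fps_expansion (F 0) 0" and ?B = "fps_expansion (F 1) 0"
  have IH: "(\<forall>j<k. fps_nth ?B (2 * j + 1) = 0) \<and>
      (deriv (F (Suc k)) 0 \<noteq> 0 \<longrightarrow> fps_nth ?B (2 * k + 1) \<noteq> 0)"
    using Suc.IH[of "\<lambda>i. F (Suc i)"] Suc.prems by simp
  have "F 0 has_fps_expansion ?A" "F 1 has_fps_expansion ?B"
    using Suc.prems(1)[of 0] Suc.prems(1)[of 1] by (simp_all add: analytic_at_imp_has_fps_expansion_0)
  moreover have "\<forall>\<^sub>F s in nhds 0. deriv (F 0) s = 2 * s * F 1 s"
    using Suc.prems(2)[of 0] by simp
  ultimately have A1: "fps_nth ?A 1 = 0"
    and AB: "of_nat (Suc (Suc n)) * fps_nth ?A (Suc (Suc n)) = 2 * fps_nth ?B n" for n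
    using coefficients_of_primitive by blast+
  have step: "of_nat (2 * j + 3) * fps_nth ?A (2 * Suc j + 1) = 2 * fps_nth ?B (2 * j + 1)" for j
    using AB[of "2 * j + 1"] by (simp add: eval_nat_numeral)
  have "fps_nth ?A (2 * j + 1) = 0" if j: "j < Suc k" for j
  proof (cases j)
    case 0
    then show ?thesis using A1 by simp
  next
    case (Suc i)
    have "of_nat (2 * i + 3) \<noteq> (0 :: complex)" by (simp only: of_nat_eq_0_iff)
    moreover have "fps_nth ?B (2 * i + 1) = 0" using IH j Suc by simp
    ultimately show ?thesis using step[of i] Suc by (metis mult_eq_0_iff mult_zero_right)
  qed
  moreover have "fps_nth ?A (2 * Suc k + 1) \<noteq> 0" if "deriv (F (Suc k)) 0 \<noteq> 0"
    using step[of k] IH that by (metis mult_eq_0_iff mult_zero_right zero_neq_numeral)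
  ultimately show ?case by blast
qed

lemma deriv_compose_near:
  fixes f \<tau> :: "complex \<Rightarrow> complex"
  assumes "f analytic_on {0}" "\<tau> analytic_on {0}" "\<tau> 0 = 0"
  shows "\<forall>\<^sub>F s in nhds 0. deriv (\<lambda>s. f (\<tau> s)) s = deriv f (\<tau> s) * deriv \<tau> s"
proof -
  have "(\<tau> \<longlongrightarrow> 0) (nhds 0)"
    using analytic_at_imp_isCont[OF assms(2)] assms(3)
    by (simp add: continuous_at isCont_def tendsto_nhds_iff)
  then have "\<forall>\<^sub>F s in nhds 0. f analytic_on {\<tau> s}"
    using eventually_analytic[OF assms(1)] by (rule eventually_compose_filterlim[rotated])
  with eventually_analytic[OF assms(2)] show ?thesis
  proof eventually_elim
    case (elim s)
    then have "\<tau> field_differentiable at s" "f field_differentiable at (\<tau> s)"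
      by (auto intro: analytic_on_imp_differentiable_at)
    then show ?case using deriv_chain[of \<tau> s f] by (simp add: o_def)
  qed
qed

section \<open>The normal form of the curve\<close>

text \<open>
  Complex differentiability of scalar functions on \<open>\<complex>\<^sup>n\<close>, the componentwise counterpart of
  \<open>holo_map_on\<close>.
\<close>

definition holo_fun_at :: "(complex ^ 'n::finite \<Rightarrow> complex) \<Rightarrow> complex ^ 'n \<Rightarrow> bool" where
  "holo_fun_at f x \<longleftrightarrow> (\<exists>f'. (f has_derivative f') (at x) \<and> (\<forall>c v. f' (c *s v) = c * f' v))"

lemma holo_fun_at_component: "holo_fun_at (\<lambda>x. x $ i) x"
  unfolding holo_fun_at_def
  by (intro exI[of _ "\<lambda>v. v $ i"] conjI bounded_linear_imp_has_derivative bounded_linear_vec_nth) simp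

lemma holo_fun_at_add:
  assumes "holo_fun_at f x" "holo_fun_at g x"
  shows "holo_fun_at (\<lambda>x. f x + g x) x"
proof -
  obtain f' g' where "(f has_derivative f') (at x)" "\<And>c v. f' (c *s v) = c * f' v"
    "(g has_derivative g') (at x)" "\<And>c v. g' (c *s v) = c * g' v"
    using assms unfolding holo_fun_at_def by blast
  then show ?thesis unfolding holo_fun_at_def
    by (intro exI[of _ "\<lambda>h. f' h + g' h"] conjI has_derivative_add) (auto simp: algebra_simps)
qed

lemma holo_fun_at_mult:
  assumes "holo_fun_at f x" "holo_fun_at g x"
  shows "holo_fun_at (\<lambda>x. f x * g x) x"
proof -
  obtain f' g' where "(f has_derivative f') (at x)" "\<And>c v. f' (c *s v) = c * f' v"
    "(g has_derivative g') (at x)" "\<And>c v. g' (c *s v) = c * g' v"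
    using assms unfolding holo_fun_at_def by blast
  then show ?thesis unfolding holo_fun_at_def
    by (intro exI[of _ "\<lambda>h. f x * g' h + f' h * g x"] conjI has_derivative_mult)
      (auto simp: algebra_simps)
qed

lemma holo_fun_at_compose:
  assumes "holo_fun_at f x" "g field_differentiable at (f x)"
  shows "holo_fun_at (\<lambda>x. g (f x)) x"
proof -
  obtain f' where f': "(f has_derivative f') (at x)" "\<And>c v. f' (c *s v) = c * f' v"
    using assms unfolding holo_fun_at_def by blast
  obtain g' where "(g has_derivative (*) g') (at (f x))"
    using assms(2) by (auto simp: field_differentiable_def has_field_derivative_def)
  then have "((\<lambda>x. g (f x)) has_derivative (\<lambda>h. g' * f' h)) (at x)"
    using has_derivative_compose[OF f'(1)] by blast
  then show ?thesis unfolding holo_fun_at_def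
    by (intro exI[of _ "\<lambda>h. g' * f' h"] conjI) (auto simp: f' algebra_simps)
qed

lemma holo_fun_at_const: "holo_fun_at (\<lambda>x. c) x"
  unfolding holo_fun_at_def by (intro exI[of _ "\<lambda>h. 0"]) simp

lemma holo_fun_at_diff:
  assumes "holo_fun_at f x" "holo_fun_at g x"
  shows "holo_fun_at (\<lambda>x. f x - g x) x"
  using holo_fun_at_add[OF assms(1) holo_fun_at_mult[OF holo_fun_at_const[of "- 1"] assms(2)]] by simp

lemma holo_fun_at_divide:
  assumes "holo_fun_at f x" "holo_fun_at g x" "g x \<noteq> 0"
  shows "holo_fun_at (\<lambda>x. f x / g x) x"
proof -
  have "holo_fun_at (\<lambda>x. inverse (g x)) x"
    using assms(2,3) DERIV_inverse[of "g x" UNIV]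
    by (intro holo_fun_at_compose[of g x inverse]) (auto simp: field_differentiable_def)
  from holo_fun_at_mult[OF assms(1) this] show ?thesis by (simp add: divide_inverse)
qed

lemmas holo_fun_at_intros = holo_fun_at_component holo_fun_at_add holo_fun_at_diff holo_fun_at_mult
  holo_fun_at_divide holo_fun_at_const

lemma holo_map_onI:
  fixes f :: "complex ^ 'n::finite \<Rightarrow> complex ^ 'n"
  assumes "open U" and "\<And>x i. x \<in> U \<Longrightarrow> holo_fun_at (\<lambda>x. f x $ i) x"
  shows "holo_map_on f U"
  unfolding holo_map_on_def
proof (intro conjI ballI)
  fix x assume "x \<in> U"
  then have "\<forall>i. \<exists>f'. ((\<lambda>x. f x $ i) has_derivative f') (at x) \<and> (\<forall>c v. f' (c *s v) = c * f' v)"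
    using assms(2) by (auto simp: holo_fun_at_def)
  then obtain f' where f': "\<And>i. ((\<lambda>x. f x $ i) has_derivative f' i) (at x)"
    "\<And>i c v. f' i (c *s v) = c * f' i v"
    by metis
  have "(f has_derivative (\<lambda>h. \<chi> i. f' i h)) (at x)"
    unfolding has_derivative_componentwise_within[of f]
  proof
    fix B :: "complex ^ 'n" assume "B \<in> Basis"
    then obtain i u where B: "B = axis i u" by (auto simp: Basis_vec_def)
    show "((\<lambda>x. f x \<bullet> B) has_derivative (\<lambda>h. (\<chi> i. f' i h) \<bullet> B)) (at x)"
      unfolding B inner_axis using has_derivative_inner_left[OF f'(1)] by simp
  qed
  then show "\<exists>f'. (f has_derivative f') (at x) \<and> (\<forall>c v. f' (c *s v) = c *s f' v)"
    by (intro exI[of _ "\<lambda>h. \<chi> i. f' i h"]) (auto simp: f'(2) vec_eq_iff)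
qed (fact assms(1))

lemma holo_map_on_transform:
  assumes "holo_map_on f U" "\<And>x. x \<in> U \<Longrightarrow> g x = f x"
  shows "holo_map_on g U"
  using assms unfolding holo_map_on_def by (metis has_derivative_transform_within_open)

text \<open>
  On the curve \<open>x\<^sub>a - x\<^sub>0 = s\<^sup>2\<close>, so there the function \<open>q = (x\<^sub>b - E\<^sub>b) / G\<^sub>b\<close> of \<open>x\<close> equals \<open>s\<^bsup>2k+1\<^esup>\<close>, and
  \<open>x\<^sub>d - E\<^sub>d - G\<^sub>d q\<close> vanishes. The change of coordinates \<open>\<Phi>\<close> built from these functions is triangular, with
  inverse \<open>\<Psi>\<close>, and is holomorphic near the points where \<open>G\<^sub>b(x\<^sub>a - x\<^sub>0)\<close> is not zero.
\<close>

lemma A_even_singularity_normal_form: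
  fixes \<gamma> :: "complex \<Rightarrow> complex ^ 'n::finite" and E G :: "'n \<Rightarrow> complex \<Rightarrow> complex"
  assumes \<tau>: "\<tau> analytic_on {0}" "\<tau> 0 = 0" "deriv \<tau> 0 \<noteq> 0" and ba: "b \<noteq> a"
    and EG: "\<And>d. E d analytic_on {0}" "\<And>d. G d analytic_on {0}" "G b 0 \<noteq> 0"
    and \<gamma>0: "\<gamma> 0 $ a = x0"
    and \<gamma>a: "\<forall>\<^sub>F s in nhds 0. \<gamma> (\<tau> s) $ a = x0 + s ^ 2"
    and \<gamma>d: "\<And>d. d \<noteq> a \<Longrightarrow>
      \<forall>\<^sub>F s in nhds 0. \<gamma> (\<tau> s) $ d = E d (s ^ 2) + s ^ (2 * k + 1) * G d (s ^ 2)"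
  shows "A_even_singularity k \<gamma>"
proof -
  have "\<forall>\<^sub>F t in nhds 0. G b t \<noteq> 0"
  proof -
    have "(G b \<longlongrightarrow> G b 0) (at 0)" using EG(2) analytic_at_imp_isCont isCont_def by blast
    then have "\<forall>\<^sub>F t in at 0. G b t \<noteq> 0" using EG(3) by (rule tendsto_imp_eventually_ne)
    then show ?thesis using EG(3) by (simp add: eventually_nhds_conv_at)
  qed
  moreover have "\<forall>\<^sub>F t in nhds 0. \<forall>d\<in>UNIV. E d analytic_on {t} \<and> G d analytic_on {t}"
    by (intro eventually_ball_finite ballI eventually_conj eventually_analytic EG) simp
  ultimately have "\<forall>\<^sub>F t in nhds 0. G b t \<noteq> 0 \<and> (\<forall>d. E d analytic_on {t} \<and> G d analytic_on {t})"
    by eventually_elim simp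
  then obtain S where S: "open S" "0 \<in> S" "\<And>t. t \<in> S \<Longrightarrow> G b t \<noteq> 0"
    "\<And>t d. t \<in> S \<Longrightarrow> E d field_differentiable at t"
    "\<And>t d. t \<in> S \<Longrightarrow> G d field_differentiable at t"
    unfolding eventually_nhds using analytic_on_imp_differentiable_at by (metis singletonI)
  define q where "q x = (x $ b - E b (x $ a - x0)) / G b (x $ a - x0)" for x :: "complex ^ 'n"
  define \<Phi> where "\<Phi> x = (\<chi> d. if d = a then x $ a - x0 else if d = b then q x
      else x $ d - E d (x $ a - x0) - G d (x $ a - x0) * q x)" for x
  define \<Psi> where "\<Psi> X = (\<chi> d. if d = a then X $ a + x0 else
      E d (X $ a) + G d (X $ a) * X $ b + (if d = b then 0 else X $ d))" for X :: "complex ^ 'n"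
  define U where "U = (\<lambda>x::complex ^ 'n. x $ a - x0) -` S"
  define W where "W = (\<lambda>X::complex ^ 'n. X $ a) -` S"
  have op: "open U" "open W"
    unfolding U_def W_def by (intro open_vimage S(1) continuous_intros)+
  have inv1: "\<Psi> (\<Phi> x) = x" "\<Phi> x \<in> W" if "x \<in> U" for x
  proof -
    have nz: "G b (x $ a - x0) \<noteq> 0" using that S(3) by (simp add: U_def)
    show "\<Psi> (\<Phi> x) = x"
      using nz ba unfolding \<Psi>_def \<Phi>_def by (auto simp: vec_eq_iff q_def)
    show "\<Phi> x \<in> W" using that by (simp add: U_def W_def \<Phi>_def)
  qed
  have inv2: "\<Phi> (\<Psi> X) = X" "\<Psi> X \<in> U" if "X \<in> W" for X
  proof -
    have "G b (X $ a) \<noteq> 0" using that S(3) by (simp add: W_def)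
    then have q: "q (\<Psi> X) = X $ b" using ba by (simp add: q_def \<Psi>_def)
    show "\<Phi> (\<Psi> X) = X"
      using ba unfolding \<Phi>_def q by (auto simp: vec_eq_iff \<Psi>_def)
    show "\<Psi> X \<in> U" using that by (simp add: U_def W_def \<Psi>_def)
  qed
  have bij: "bij_betw \<Phi> U W"
    by (rule bij_betwI[where g = \<Psi>]) (use inv1 inv2 in auto)
  have "holo_map_on \<Phi> U"
  proof (rule holo_map_onI[OF op(1)])
    fix x i assume "x \<in> U"
    then have x: "x $ a - x0 \<in> S" by (simp add: U_def)
    note EGx = holo_fun_at_compose[of "\<lambda>x. x $ a - x0", OF _ S(4)[OF x]]
      holo_fun_at_compose[of "\<lambda>x. x $ a - x0", OF _ S(5)[OF x]]
    have q: "holo_fun_at q x"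
      unfolding q_def by (intro holo_fun_at_intros EGx S(3)[OF x])
    consider "i = a" | "i = b" "i \<noteq> a" | "i \<noteq> a" "i \<noteq> b" by blast
    then show "holo_fun_at (\<lambda>x. \<Phi> x $ i) x"
    proof cases
      case 1
      then show ?thesis unfolding \<Phi>_def by (simp) (intro holo_fun_at_intros)
    next
      case 2
      then show ?thesis unfolding \<Phi>_def using q by simp
    next
      case 3
      then show ?thesis unfolding \<Phi>_def by (simp) (intro holo_fun_at_intros EGx q)
    qed
  qed
  moreover have "holo_map_on \<Psi> W"
  proof (rule holo_map_onI[OF op(2)])
    fix x i assume "x \<in> W"
    then have x: "x $ a \<in> S" by (simp add: W_def)
    note EGx = holo_fun_at_compose[of "\<lambda>x. x $ a", OF _ S(4)[OF x]]
      holo_fun_at_compose[of "\<lambda>x. x $ a", OF _ S(5)[OF x]]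
    show "holo_fun_at (\<lambda>x. \<Psi> x $ i) x"
      unfolding \<Psi>_def by (cases "i = a"; cases "i = b"; simp; intro holo_fun_at_intros EGx)
  qed
  then have "holo_map_on (inv_into U \<Phi>) W"
  proof (rule holo_map_on_transform)
    fix X assume "X \<in> W"
    then show "inv_into U \<Phi> X = \<Psi> X"
      using inv2 bij by (metis bij_betw_inv_into_left)
  qed
  moreover have "\<gamma> 0 \<in> U" using \<gamma>0 S(2) by (simp add: U_def)
  moreover have "\<forall>\<^sub>F t in nhds 0. \<gamma> (\<tau> t) \<in> U \<and>
      \<Phi> (\<gamma> (\<tau> t)) = (\<chi> i. if i = a then t ^ 2 else if i = b then t ^ (2 * k + 1) else 0)"
  proof -
    have lim: "((\<lambda>t::complex. t ^ 2) \<longlongrightarrow> 0) (nhds 0)"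
      using tendsto_power[OF filterlim_ident[of "nhds (0::complex)"], of 2] by simp
    have "\<forall>\<^sub>F t in nhds 0. t ^ 2 \<in> S"
      using eventually_compose_filterlim[OF eventually_nhds_in_open[OF S(1,2)] lim] .
    moreover have "\<forall>\<^sub>F t in nhds 0. \<forall>d\<in>- {a}. \<gamma> (\<tau> t) $ d = E d (t ^ 2) + t ^ (2 * k + 1) * G d (t ^ 2)"
      by (intro eventually_ball_finite ballI \<gamma>d) auto
    ultimately show ?thesis using \<gamma>a
    proof eventually_elim
      case (elim t)
      have xa: "\<gamma> (\<tau> t) $ a - x0 = t ^ 2" using elim(3) by simp
      have q: "q (\<gamma> (\<tau> t)) = t ^ (2 * k + 1)"
        unfolding q_def xa using elim(2) ba S(3)[OF elim(1)] by simp
      have "\<Phi> (\<gamma> (\<tau> t)) = (\<chi> i. if i = a then t ^ 2 else if i = b then t ^ (2 * k + 1) else 0)"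
        unfolding \<Phi>_def q xa using elim(2) by (auto simp: vec_eq_iff)
      moreover have "\<gamma> (\<tau> t) \<in> U" using elim(1) xa by (simp add: U_def)
      ultimately show ?case by blast
    qed
  qed
  ultimately show ?thesis
    unfolding A_even_singularity_def
    by (intro exI[of _ \<Phi>] exI[of _ U] exI[of _ W] exI[of _ \<tau>] exI[of _ a] exI[of _ b] conjI)
      (assumption | rule bij \<tau> ba[symmetric])+
qed

text \<open>
  \<open>F i d\<close> is the \<open>i\<close>-th derivative of the \<open>d\<close>-th coordinate with respect to \<open>x = F 0 a\<close>. In the parameter
  with \<open>x = x\<^sub>0 + s\<^sup>2\<close> the equations become \<open>F\<^sub>i' = 2 s F\<^sub>i\<^sub>+\<^sub>1\<close>.
\<close>

lemma A_even_singularity_criterion: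
  fixes \<gamma> :: "complex \<Rightarrow> complex ^ 'n::finite" and F :: "nat \<Rightarrow> 'n \<Rightarrow> complex \<Rightarrow> complex"
  assumes ba: "b \<noteq> a" and an: "\<And>i d. F i d analytic_on {0}"
    and \<gamma>: "\<forall>\<^sub>F t in nhds 0. \<forall>d. \<gamma> t $ d = F 0 d t"
    and ode: "\<And>i d. i < k \<Longrightarrow> d \<noteq> a \<Longrightarrow>
      \<forall>\<^sub>F t in nhds 0. deriv (F i d) t = F (Suc i) d t * deriv (F 0 a) t"
    and x1: "deriv (F 0 a) 0 = 0" and x2: "deriv (deriv (F 0 a)) 0 \<noteq> 0"
    and yb: "deriv (F k b) 0 \<noteq> 0"
  shows "A_even_singularity k \<gamma>"
proof -
  obtain \<tau> where \<tau>: "\<tau> analytic_on {0}" "\<tau> 0 = 0" "deriv \<tau> 0 \<noteq> 0"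
    "\<forall>\<^sub>F s in nhds 0. F 0 a (\<tau> s) = F 0 a 0 + s ^ 2"
    using quadratic_parameter[OF an x1 x2] by metis
  have lim: "(\<tau> \<longlongrightarrow> 0) (nhds 0)"
    using analytic_at_imp_isCont[OF \<tau>(1)] \<tau>(2)
    by (simp add: continuous_at isCont_def tendsto_nhds_iff)
  define H where "H i d s = F i d (\<tau> s)" for i d s
  have H: "H i d analytic_on {0}" for i d
    using analytic_on_compose_gen[OF \<tau>(1), of "F i d" "{0}"] an \<tau>(2) by (simp add: H_def[abs_def] o_def)
  have dH: "\<forall>\<^sub>F s in nhds 0. deriv (H i d) s = deriv (F i d) (\<tau> s) * deriv \<tau> s" for i d
    using deriv_compose_near[OF an \<tau>(1,2), of i d] by (simp add: H_def[abs_def])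
  have "\<forall>\<^sub>F s in nhds 0. \<forall>\<^sub>F t in nhds s. H 0 a t = F 0 a 0 + t ^ 2"
    using \<tau>(4) by (simp add: H_def eventually_eventually)
  then have dHa: "\<forall>\<^sub>F s in nhds 0. deriv (H 0 a) s = 2 * s"
  proof eventually_elim
    case (elim s)
    have "deriv (H 0 a) s = deriv (\<lambda>t. F 0 a 0 + t ^ 2) s" by (rule deriv_cong_ev[OF elim refl])
    also have "\<dots> = 2 * s" by (rule DERIV_imp_deriv) (auto intro!: derivative_eq_intros)
    finally show ?case .
  qed
  have odeH: "\<forall>\<^sub>F s in nhds 0. deriv (H i d) s = 2 * s * H (Suc i) d s" if "i < k" "d \<noteq> a" for i d
    using dH[of i d] dH[of 0 a] dHa eventually_compose_filterlim[OF ode[OF that] lim]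
  proof eventually_elim
    case (elim s)
    have "deriv (H i d) s = F (Suc i) d (\<tau> s) * (deriv (F 0 a) (\<tau> s) * deriv \<tau> s)"
      unfolding elim(1) elim(4) by (rule mult.assoc)
    also have "\<dots> = F (Suc i) d (\<tau> s) * (2 * s)"
      unfolding elim(2)[symmetric] elim(3) ..
    finally show ?case by (simp add: H_def mult.commute)
  qed
  define split where "split d E G \<longleftrightarrow>
      E analytic_on {0} \<and> G analytic_on {0} \<and> (d = b \<longrightarrow> G 0 \<noteq> 0) \<and>
      (\<forall>\<^sub>F s in nhds 0. H 0 d s = E (s ^ 2) + s ^ (2 * k + 1) * G (s ^ 2))" for d E G
  have "\<exists>E G. split d E G" if "d \<noteq> a" for d
  proof -
    let ?A = "fps_expansion (H 0 d) 0"
    have *: "(\<forall>j<k. fps_nth ?A (2 * j + 1) = 0) \<and>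
        (deriv (H k d) 0 \<noteq> 0 \<longrightarrow> fps_nth ?A (2 * k + 1) \<noteq> 0)"
      using iterated_primitives[of k "\<lambda>i. H i d"] H odeH that by simp
    have top: "deriv (H k b) 0 \<noteq> 0"
      using eventually_nhds_x_imp_x[OF dH[of k b]] yb \<tau>(2,3) by simp
    have exp: "H 0 d has_fps_expansion ?A" using H by (rule analytic_at_imp_has_fps_expansion_0)
    have odd: "\<And>j. j < k \<Longrightarrow> fps_nth ?A (2 * j + 1) = 0" using * by blast
    show ?thesis
    proof (rule even_odd_decomposition[OF exp odd])
      fix E G assume EG: "E analytic_on {0}" "G analytic_on {0}" "G 0 = fps_nth ?A (2 * k + 1)"
        "\<forall>\<^sub>F s in nhds 0. H 0 d s = E (s ^ 2) + s ^ (2 * k + 1) * G (s ^ 2)"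
      have "d = b \<longrightarrow> G 0 \<noteq> 0" unfolding EG(3) using * top by blast
      with EG(1,2,4) show ?thesis unfolding split_def by blast
    qed
  qed
  then obtain E G where "\<And>d. d \<noteq> a \<Longrightarrow> split d (E d) (G d)" by metis
  then have EG: "E d analytic_on {0}" "G d analytic_on {0}" "d = b \<Longrightarrow> G d 0 \<noteq> 0"
    "\<forall>\<^sub>F s in nhds 0. H 0 d s = E d (s ^ 2) + s ^ (2 * k + 1) * G d (s ^ 2)" if "d \<noteq> a" for d
    using that unfolding split_def by blast+
  \<comment> \<open>the coordinate \<open>a\<close> itself is not decomposed; 0 only serves to make all entries analytic\<close>
  define E' G' where "E' d = (if d = a then (\<lambda>_. 0) else E d)" and "G' d = (if d = a then (\<lambda>_. 0) else G d)" for d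
  have \<gamma>\<tau>: "\<forall>\<^sub>F s in nhds 0. \<forall>d. \<gamma> (\<tau> s) $ d = H 0 d s"
    using eventually_compose_filterlim[OF \<gamma> lim] by (simp add: H_def)
  show ?thesis
  proof (rule A_even_singularity_normal_form[OF \<tau>(1-3) ba, of E' G' \<gamma> "F 0 a 0" k])
    show "\<gamma> 0 $ a = F 0 a 0" using eventually_nhds_x_imp_x[OF \<gamma>] by simp
    show "\<forall>\<^sub>F s in nhds 0. \<gamma> (\<tau> s) $ a = F 0 a 0 + s ^ 2"
      using \<gamma>\<tau> \<tau>(4) by eventually_elim (simp add: H_def)
    show "\<forall>\<^sub>F s in nhds 0. \<gamma> (\<tau> s) $ d = E' d (s ^ 2) + s ^ (2 * k + 1) * G' d (s ^ 2)"
      if "d \<noteq> a" for d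
      using \<gamma>\<tau> EG(4)[OF that]
      by eventually_elim (simp add: E'_def G'_def that)
  qed (use EG ba in \<open>auto simp: E'_def G'_def\<close>)
qed

section \<open>Curves through points with code RR...RV\<close>

lemma Delta_vector_nonzero:
  assumes "z \<in> chart_dom w" "v \<in> Delta (length w) z" "v \<noteq> tzero"
  shows "v w (length w) \<noteq> 0"
proof
  assume "v w (length w) = 0"
  moreover have "tzero \<in> Delta (length w) z"
    using Delta_scale[OF good_chart assms(1,2), of 0] by (simp add: tzero_def)
  ultimately have "v = tzero"
    by (intro Delta_eqI[OF good_chart assms(1,2)]) (simp_all add: tzero_def)
  with assms(3) show False by simp
qed

text \<open>
  A single letter \<open>a\<close> serves all levels: regular lines are transverse to the fibre, and hence
  \<open>dx\<^sub>a\<close> remains nonzero on them.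
\<close>

lemma regular_point_chart:
  fixes z :: "'n::finite mpoint"
  assumes "z \<in> monster k" "rvt_code z = replicate k R"
  shows "\<exists>a. z \<in> chart_dom (replicate k a)"
  using assms
proof (induction k arbitrary: z)
  case 0
  then show ?case by (auto simp: chart_dom_def monster_0)
next
  case (Suc k)
  obtain z' l where z: "z = Prol z' l" "z' \<in> monster k" "is_line (Delta k z') l"
    using Suc.prems(1) by (rule monster_SucE)
  have code: "rvt_code z' = replicate k R" and reg: "regular_line k z' l"
    using Suc.prems(2) monster_level[OF z(2)]
    by (auto simp: z(1) replicate_append_same[symmetric] split: if_splits)
  obtain v where v: "v \<noteq> tzero" "v \<in> l" "v \<in> Delta k z'"
    using z(3) tspan_self by (auto simp: is_line_def)
  obtain a where a: "z' \<in> chart_dom (replicate k a)" using Suc.IH[OF z(2) code] by blast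
  show ?case
  proof (cases k)
    case 0
    then have "v [] 0 \<noteq> 0" using Delta_vector_nonzero[of z' "[]" v] a v by simp
    then obtain c where "v [] 0 $ c \<noteq> 0" by (auto simp: vec_eq_iff)
    then have "z \<in> chart_dom [c]"
      unfolding z(1) chart_dom_Cons using a v z(3) 0 by auto
    then show ?thesis using 0 by (intro exI[of _ c]) simp
  next
    case (Suc j)
    have "v (a # replicate j a) (Suc (length (replicate j a))) $ a \<noteq> 0"
      by (rule regular_line_transverse_to_fibre[where l = l]) (use a reg v Suc in simp_all)
    then have "z \<in> chart_dom (a # replicate k a)"
      unfolding z(1) chart_dom_Cons using a v z(3) Suc by auto
    then show ?thesis by (intro exI[of _ a]) simp
  qed
qed

text \<open>
  In the charts with constant word \<open>a\<close>, the contact equations are \<open>dy\<^sub>i = y\<^sub>i\<^sub>+\<^sub>1 dx\<^sub>a\<close>.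
\<close>

lemma contact_lift_replicate:
  "i < k \<Longrightarrow> contact_lift (replicate k a) y u i = u $ a *s affine_vec a (y (Suc i))"
proof (induction k arbitrary: u)
  case (Suc k)
  show ?case
  proof (cases "i = k")
    case True
    then show ?thesis using contact_lift_top[of "replicate k a"] by simp
  next
    case False
    then show ?thesis using Suc.IH[of "affine_vec a (y (Suc k))"] Suc.prems
      by (simp add: affine_vec_def)
  qed
qed simp

text \<open>
  In the chart \<open>b # replicate k a\<close>, \<open>F (Suc k) a\<close> is the coordinate \<open>dx / dy\<^sub>k\<^sub>,\<^sub>b\<close>, and \<open>F (Suc k) b\<close> is a
  copy of \<open>y\<^sub>k\<^sub>,\<^sub>b\<close>. The contact equations and the two transversality lemmas supply the hypotheses of
  \<open>A_even_singularity_criterion\<close>.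
\<close>

lemma regular_germ_imp_A_even:
  fixes \<gamma> :: "complex \<Rightarrow> complex ^ 'n::finite"
  assumes c: "regular_germ (Suc k) c" and code: "rvt_code (c 0) = replicate k R @ [V]"
    and k: "k \<ge> 1" and \<gamma>: "\<forall>\<^sub>F t in nhds 0. base_point (c t) = \<gamma> t"
  shows "A_even_singularity k \<gamma>"
proof -
  have holo: "holo_germ (monster (Suc k)) c"
    and int: "\<forall>\<^sub>F t in nhds 0. velocity c t \<in> Delta (Suc k) (c t)"
    and nz: "velocity c 0 \<noteq> tzero" and reg: "regular_line (Suc k) (c 0) (tspan (velocity c 0))"
    using c by (auto simp: regular_germ_def integral_germ_def)
  have "c 0 \<in> monster (Suc k)"
    using holo by (auto simp: holo_germ_def dest: eventually_nhds_x_imp_x)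
  then obtain z l where z: "c 0 = Prol z l" "z \<in> monster k" "is_line (Delta k z) l"
    by (rule monster_SucE)
  have zcode: "rvt_code z = replicate k R" and vert: "vertical_line k z l"
    using code monster_level[OF z(2)] by (auto simp: z(1) split: if_splits)
  obtain a where za: "z \<in> chart_dom (replicate k a)" using regular_point_chart[OF z(2) zcode] by blast
  obtain j where j: "k = Suc j" using k by (cases k) auto
  define u where "u = replicate j a"
  define w where "w = a # u"
  have zw: "z \<in> chart_dom w" and w: "w = replicate k a" and lenw: "length w = k"
    and lenu: "Suc (length u) = k"
    using za by (simp_all add: w_def u_def j)
  obtain v where v: "v \<noteq> tzero" "v \<in> l" "v \<in> Delta k z" "l = tspan v"
    using z(3) tspan_self by (auto simp: is_line_def)
  have va: "v w k $ a = 0"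
    using vertical_line_coord[of z a u l v] zw vert v(2) lenu by (simp add: w_def)
  have "v w k \<noteq> 0" using Delta_vector_nonzero[OF zw] v lenw by simp
  then obtain b where vb: "v w k $ b \<noteq> 0" by (auto simp: vec_eq_iff)
  have ba: "b \<noteq> a" using va vb by auto
  define W where "W = b # w"
  have lenW: "length W = Suc k" using lenw by (simp add: W_def)
  have dom: "c 0 \<in> chart_dom W"
    unfolding z(1) W_def chart_dom_Cons using zw z(3) v(2) vb lenw by auto
  have cg: "chart_germ W c" by (rule holo_germ_imp_chart_germ[OF holo dom lenW])
  have ev: "\<forall>\<^sub>F t in nhds 0. c t \<in> chart_dom W" using cg by (simp add: chart_germ_def)
  define F where "F i d t = chart W (c t) i $ d" for i d t
  have an: "F i d analytic_on {0}" for i d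
    using cg by (simp add: F_def[abs_def] chart_germ_def)
  have vel: "velocity c t W i $ d = deriv (F i d) t" if "c t \<in> chart_dom W" for t i d
    using that by (simp add: velocity_def F_def[abs_def] chart_dom_def)
  let ?dy = "deriv (F (Suc k) b)"
  have ev_near: "\<forall>\<^sub>F t in nhds 0. \<forall>\<^sub>F s in nhds t. c s \<in> chart_dom W"
    using ev by (simp add: eventually_eventually)
  \<comment> \<open>entry \<open>b\<close> of the last row is the copy of \<open>y\<^sub>k\<^sub>,\<^sub>b\<close>\<close>
  have ub: "\<forall>\<^sub>F t in nhds 0. ?dy t = deriv (F k b) t"
    using ev_near ev
  proof eventually_elim
    case (elim t)
    show ?case
      using velocity_proj(2)[OF elim(1)[unfolded W_def]] vel[OF elim(2)]
      by (simp add: W_def[symmetric] lenw)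
  qed
  have contact: "\<forall>\<^sub>F t in nhds 0. \<forall>i<k. \<forall>d.
      deriv (F i d) t = ?dy t * (F (Suc k) a t * (if d = a then 1 else F (Suc i) d t))"
    using ev int
  proof eventually_elim
    case (elim t)
    have "velocity c t \<in> Delta (length W) (c t)" unfolding lenW by (rule elim(2))
    from Delta_lift[OF good_chart elim(1) this]
    have contact_lift: "velocity c t W = contact_lift W (chart W (c t)) (velocity c t W (Suc k))"
      unfolding lenW .
    have "velocity c t W i $ d = velocity c t W (Suc k) $ b *
        (chart W (c t) (Suc k) $ a * affine_vec a (chart W (c t) (Suc i)) $ d)" if "i < k" for i d
    proof -
      have "velocity c t W i = velocity c t W (Suc k) $ b *s
          contact_lift w (chart W (c t)) (affine_vec b (chart W (c t) (Suc k))) i"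
        unfolding fun_cong[OF contact_lift, of i] unfolding W_def using that lenw by simp
      also have "contact_lift w (chart W (c t)) (affine_vec b (chart W (c t) (Suc k))) i =
          chart W (c t) (Suc k) $ a *s affine_vec a (chart W (c t) (Suc i))"
        using that ba by (simp add: w contact_lift_replicate affine_vec_def)
      finally show ?thesis by simp
    qed
    then show ?case
      by (simp add: vel[OF elim(1)]) (simp add: F_def affine_vec_def)
  qed
  \<comment> \<open>for \<open>i = 0\<close> and \<open>d = a\<close>, the contact equation reads \<open>x' = (dx / dy\<^sub>k\<^sub>,\<^sub>b) y\<^sub>k\<^sub>,\<^sub>b'\<close>\<close>
  have x': "\<forall>\<^sub>F t in nhds 0. deriv (F 0 a) t = ?dy t * F (Suc k) a t"
    using contact by eventually_elim (use k in auto)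
  have dir: "velocity c 0 W (Suc k) $ b \<noteq> 0"
    using regular_line_transverse_to_fibre[OF _ _ tspan_self nz, of "c 0" b w] dom reg lenw
    by (simp add: W_def)
  then have u0: "?dy 0 \<noteq> 0" using vel[OF dom] by simp
  have "velocity c 0 W (Suc k) $ a \<noteq> 0"
    using regular_line_transverse_to_prolonged_fibre[of z l b a u, OF _ ba _ _ tspan_self nz] dom reg vert lenu
    by (simp add: W_def w_def z(1))
  then have ya': "deriv (F (Suc k) a) 0 \<noteq> 0" using vel[OF dom] by simp
  have ya: "F (Suc k) a 0 = 0"
    using chart_Cons_top(1)[of z v b w a] dom va ba lenw
    by (simp add: F_def z(1) v(4) W_def del: chart.simps)
  show ?thesis
  proof (rule A_even_singularity_criterion[OF ba, of F])
    show "F i d analytic_on {0}" for i d by (rule an)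
    show "\<forall>\<^sub>F t in nhds 0. \<forall>d. \<gamma> t $ d = F 0 d t"
      using \<gamma> ev by eventually_elim (auto simp: F_def chart_base_point chart_dom_def)
    show "\<forall>\<^sub>F t in nhds 0. deriv (F i d) t = F (Suc i) d t * deriv (F 0 a) t"
      if "i < k" "d \<noteq> a" for i d
      using contact x' by eventually_elim (use that in \<open>simp add: mult_ac\<close>)
    show "deriv (F 0 a) 0 = 0" using eventually_nhds_x_imp_x[OF x'] ya by simp
    have "deriv (deriv (F 0 a)) 0 = deriv (\<lambda>t. ?dy t * F (Suc k) a t) 0"
      by (rule deriv_cong_ev[OF x' refl])
    also have "\<dots> = ?dy 0 * deriv (F (Suc k) a) 0"
      using an analytic_on_imp_differentiable_at[of _ "{0}" 0] analytic_deriv[OF an]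
      by (simp add: ya)
    finally show "deriv (deriv (F 0 a)) 0 \<noteq> 0" using u0 ya' by simp
    show "deriv (F k b) 0 \<noteq> 0" using eventually_nhds_x_imp_x[OF ub] u0 by simp
  qed
qed

theorem theorem3p20:
  fixes p :: "'n::finite mpoint" and \<gamma> :: "complex \<Rightarrow> complex ^ 'n" and k :: nat
  assumes "CARD('n) \<ge> 2" and "k \<ge> 1"
    and "p \<in> R_stabilization (replicate k R @ [V])"
    and "\<gamma> \<in> Germ p"
  shows "A_even_singularity k \<gamma>"
proof -
  obtain q where p: "p \<in> monster (Suc k + q)" "rvt_code p = (replicate k R @ [V]) @ replicate q R"
    using assms(3) by (auto simp: R_stabilization_def rvt_class_def)
  have lev: "level p = Suc k + q" by (rule monster_level[OF p(1)])
  obtain \<sigma> where \<sigma>: "regular_germ (Suc k + q) \<sigma>" "\<sigma> 0 = p" "\<forall>\<^sub>F t in nhds 0. base_point (\<sigma> t) = \<gamma> t"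
    using Germ_lift[OF assms(4)] unfolding lev by auto
  let ?c = "(proj ^^ q) \<circ> \<sigma>"
  have "regular_germ (Suc k) ?c \<and> rvt_code (?c 0) = replicate k R @ [V]"
    by (rule regular_germ_descend[OF \<sigma>(1)]) (use p(2) \<sigma>(2) in simp_all)
  moreover have "\<forall>\<^sub>F t in nhds 0. base_point (?c t) = \<gamma> t"
    using \<sigma>(3) by (simp add: base_point_proj_pow)
  ultimately show ?thesis using regular_germ_imp_A_even assms(2) by blast
qed

end
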